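(* Let $K$ be a field. If a graph $G$ has an $\alpha_0$-reduction $G_1,\ldots,G_s$ such that the edge ring of each $G_i$ (over $K$) has a 0-1 linear system of parameters (respectively, a star-system of parameters), then the edge ring of $G$ (over $K$) has a 0-1 linear system of parameters (respectively, a star-system of parameters).
   Context: Graphs are finite and simple. For a graph $H$ whose vertices are regarded as variables, its edge ring over $K$ is $K[V(H)]/I(H)$, where $I(H)=(xy\mid \{x,y\}\in E(H))$ is the edge ideal. The covering number $\alpha_0(H)$ is the smallest size of a vertex cover of $H$. An $\alpha_0$-reduction of $G$ is a collection of subgraphs $G_1,\ldots,G_s$ of $G$, $s\ge 2$, such that $\{V(G_i)\}_{i=1}^s$ is a partition of $V(G)$ and $\alpha_0(G)=\sum_{i=1}^s\alpha_0(G_i)$. Linear forms $f_1,\ldots,f_d\in K[V(H)]$ form a linear system of parameters for $K[V(H)]/I(H)$ if $d=\dim(K[V(H)]/I(H))$ and $\mathrm{rad}(I(H),f_1,\ldots,f_d)$ is the ideal generated by all variables in $V(H)$; it is a 0-1 linear system of parameters if all coefficients of the $f_i$ lie in $\{0,1\}\subset K$. A 0-1 linear system of parameters $\{f_1,\ldots,f_d\}$ is a star-system of parameters (associated to $\{z_1,\ldots,z_d\}\subset V(H)$) if for each $i$ one can write $f_i=z_i+\sum_{x\in A_i}x$ with $A_i\subset N_H(z_i)$, where $N_H(z)$ is the set of vertices adjacent to $z$ in $H$. *)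

theory Defs
  imports
    "HOL-Algebra.QuotRing"
    "HOL-Library.Poly_Mapping"
    "HOL-Library.Extended_Nat"
    "HOL-Library.Disjoint_Sets"
begin

section \<open>Finite simple graphs\<close>

record 'v graph =
  verts :: "'v set"
  edges :: "'v set set"

definition simple_graph :: "'v graph \<Rightarrow> bool" where
  "simple_graph H \<longleftrightarrow>
     finite (verts H) \<and> (\<forall>e\<in>edges H. e \<subseteq> verts H \<and> card e = 2)"

text \<open>Subgraphs need not be induced.\<close>

definition subgraph_of :: "'v graph \<Rightarrow> 'v graph \<Rightarrow> bool" where
  "subgraph_of H G \<longleftrightarrow>
     simple_graph H \<and> verts H \<subseteq> verts G \<and> edges H \<subseteq> edges G"

definition nbhd :: "'v graph \<Rightarrow> 'v \<Rightarrow> 'v set" where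
  "nbhd H z = {x. {z, x} \<in> edges H}"

definition vertex_cover :: "'v graph \<Rightarrow> 'v set \<Rightarrow> bool" where
  "vertex_cover H C \<longleftrightarrow> C \<subseteq> verts H \<and> (\<forall>e\<in>edges H. e \<inter> C \<noteq> {})"

definition covering_number :: "'v graph \<Rightarrow> nat" where
  "covering_number H = (LEAST k. \<exists>C. vertex_cover H C \<and> card C = k)"

definition covering_reduction :: "'v graph \<Rightarrow> nat \<Rightarrow> (nat \<Rightarrow> 'v graph) \<Rightarrow> bool" where
  "covering_reduction G s Gs \<longleftrightarrow>
     2 \<le> s \<and>
     (\<forall>i\<in>{1..s}. subgraph_of (Gs i) G) \<and>
     (\<forall>i\<in>{1..s}. verts (Gs i) \<noteq> {}) \<and>
     disjoint_family_on (\<lambda>i. verts (Gs i)) {1..s} \<and>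
     (\<Union>i\<in>{1..s}. verts (Gs i)) = verts G \<and>
     covering_number G = (\<Sum>i=1..s. covering_number (Gs i))"


section \<open>Polynomial rings and edge rings\<close>

text \<open>
  A polynomial is a finitely supported map from monomials to coefficients, a monomial being a
  finitely supported map from variables to exponents.
\<close>

type_synonym ('v, 'k) mpoly = "('v \<Rightarrow>\<^sub>0 nat) \<Rightarrow>\<^sub>0 'k"

definition mvar :: "'v \<Rightarrow> ('v, 'k::field) mpoly" where
  "mvar x = Poly_Mapping.single (Poly_Mapping.single x 1) 1"

definition mconst :: "'k \<Rightarrow> ('v, 'k::field) mpoly" where
  "mconst c = Poly_Mapping.single 0 c"

text \<open>The ring \<open>K[V]\<close>: the polynomials in which only variables from \<open>V\<close> occur.\<close>

definition mpoly_ring :: "'v set \<Rightarrow> ('v, 'k::field) mpoly ring" where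
  "mpoly_ring V =
     \<lparr>carrier = {p. \<forall>m\<in>Poly_Mapping.keys p. Poly_Mapping.keys m \<subseteq> V},
      mult = (*), one = 1, zero = 0, add = (+)\<rparr>"

lemma mpoly_ring_cring: "cring (mpoly_ring V :: ('v, 'k::field) mpoly ring)"
proof -
  let ?C = "carrier (mpoly_ring V) :: ('v, 'k) mpoly set"
  have C: "p \<in> ?C \<longleftrightarrow> (\<forall>m\<in>Poly_Mapping.keys p. Poly_Mapping.keys m \<subseteq> V)" for p
    by (simp add: mpoly_ring_def)
  have add: "p + q \<in> ?C" if "p \<in> ?C" "q \<in> ?C" for p q
    using that Poly_Mapping.keys_add[of p q] unfolding C by blast
  have mul: "p * q \<in> ?C" if p: "p \<in> ?C" and q: "q \<in> ?C" for p q
    unfolding C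
  proof
    fix m assume "m \<in> Poly_Mapping.keys (p * q)"
    then obtain a b where ab: "a \<in> Poly_Mapping.keys p" "b \<in> Poly_Mapping.keys q" "m = a + b"
      using keys_mult[of p q] by blast
    then have "Poly_Mapping.keys a \<subseteq> V" "Poly_Mapping.keys b \<subseteq> V"
      using p q unfolding C by auto
    then show "Poly_Mapping.keys m \<subseteq> V"
      using Poly_Mapping.keys_add[of a b] ab(3) by blast
  qed
  have neg: "- p \<in> ?C" if "p \<in> ?C" for p
    using that unfolding C by (simp add: in_keys_iff)
  have zero: "0 \<in> ?C" and one: "1 \<in> ?C"
    unfolding C by (simp_all add: in_keys_iff lookup_one when_def)
  have ops: "x \<oplus>\<^bsub>mpoly_ring V\<^esub> y = x + y" "x \<otimes>\<^bsub>mpoly_ring V\<^esub> y = x * y"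
      "\<zero>\<^bsub>mpoly_ring V\<^esub> = 0" "\<one>\<^bsub>mpoly_ring V\<^esub> = 1" for x y :: "('v, 'k) mpoly"
    by (simp_all add: mpoly_ring_def)
  show ?thesis
  proof (intro cringI abelian_groupI comm_monoidI, unfold ops)
    fix x assume "x \<in> ?C"
    then show "\<exists>y\<in>?C. y + x = 0"
      using neg by (intro bexI[of _ "- x"]) simp_all
  qed (fact add mul zero one | rule distrib_right | simp add: ac_simps)+
qed

definition edge_ideal :: "'v graph \<Rightarrow> ('v, 'k::field) mpoly set" where
  "edge_ideal H = genideal (mpoly_ring (verts H)) {mvar x * mvar y |x y. {x, y} \<in> edges H}"

definition edge_ring :: "'v graph \<Rightarrow> ('v, 'k::field) mpoly set ring" where
  "edge_ring H = mpoly_ring (verts H) Quot edge_ideal H"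

definition krull_dim :: "('a, 'b) ring_scheme \<Rightarrow> enat" where
  "krull_dim R =
     Sup {enat n |n. \<exists>P :: nat \<Rightarrow> 'a set.
       (\<forall>i\<le>n. primeideal (P i) R) \<and> (\<forall>i<n. P i \<subset> P (Suc i))}"

definition radical :: "('a, 'b) ring_scheme \<Rightarrow> 'a set \<Rightarrow> 'a set" where
  "radical R I = {a \<in> carrier R. \<exists>n::nat. 0 < n \<and> a [^]\<^bsub>R\<^esub> n \<in> I}"


section \<open>Linear systems of parameters\<close>

definition linear_form :: "'v set \<Rightarrow> ('v, 'k::field) mpoly \<Rightarrow> bool" where
  "linear_form V f \<longleftrightarrow> (\<exists>c. f = (\<Sum>x\<in>V. mconst (c x) * mvar x))"

text \<open>The list \<open>fs\<close> is the family of forms, in some order.\<close>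

definition linear_sop :: "'v graph \<Rightarrow> ('v, 'k::field) mpoly list \<Rightarrow> bool" where
  "linear_sop H fs \<longleftrightarrow>
     (\<forall>f\<in>set fs. linear_form (verts H) f) \<and>
     enat (length fs) = krull_dim (edge_ring H :: ('v, 'k) mpoly set ring) \<and>
     radical (mpoly_ring (verts H)) (genideal (mpoly_ring (verts H)) (edge_ideal H \<union> set fs))
       = genideal (mpoly_ring (verts H)) (mvar ` verts H)"

definition zero_one_linear_sop :: "'v graph \<Rightarrow> ('v, 'k::field) mpoly list \<Rightarrow> bool" where
  "zero_one_linear_sop H fs \<longleftrightarrow>
     linear_sop H fs \<and> (\<forall>f\<in>set fs. \<forall>m. Poly_Mapping.lookup f m \<in> {0, 1})"

text \<open>The vertices in \<open>zs\<close> are not required to be distinct.\<close>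

definition star_sop :: "'v graph \<Rightarrow> 'v list \<Rightarrow> ('v, 'k::field) mpoly list \<Rightarrow> bool" where
  "star_sop H zs fs \<longleftrightarrow>
     zero_one_linear_sop H fs \<and>
     length zs = length fs \<and> set zs \<subseteq> verts H \<and>
     (\<forall>i<length fs. \<exists>A. A \<subseteq> nbhd H (zs ! i) \<and> fs ! i = mvar (zs ! i) + (\<Sum>x\<in>A. mvar x))"

text \<open>The type argument carries the field \<open>K\<close>.\<close>

definition has_zero_one_linear_sop :: "'k::field itself \<Rightarrow> 'v graph \<Rightarrow> bool" where
  "has_zero_one_linear_sop K H \<longleftrightarrow> (\<exists>fs :: ('v, 'k) mpoly list. zero_one_linear_sop H fs)"

definition has_star_sop :: "'k::field itself \<Rightarrow> 'v graph \<Rightarrow> bool" where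
  "has_star_sop K H \<longleftrightarrow> (\<exists>zs. \<exists>fs :: ('v, 'k) mpoly list. star_sop H zs fs)"

end

theory Submission
  imports Defs
begin

text \<open>
  The union of the given systems works. Up to radical, the ideal it generates together with
  \<open>I(G)\<close> contains every variable, because \<open>I(G\<^sub>i) \<subseteq> I(G)\<close>; and it has the right length
  because \<open>dim K[V]/I(H) = |V| - \<alpha>\<^sub>0(H)\<close>, which is additive along an \<open>\<alpha>\<^sub>0\<close>-reduction.

  For this dimension formula, the prime ideals generated by the growing sets of variables that
  contain a minimum vertex cover give the lower bound. For the upper bound, let
  \<open>P\<^sub>0 \<subset> \<dots> \<subset> P\<^sub>n\<close> be primes over \<open>I(H)\<close>. The variables in \<open>P\<^sub>0\<close> form a vertex cover \<open>C\<close>,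
  so elements \<open>x\<^sub>i \<in> P\<^sub>i\<^sub>+\<^sub>1 - P\<^sub>i\<close> can be chosen in \<open>K[V - C]\<close>. They are algebraically
  independent modulo \<open>P\<^sub>0\<close>, whereas any \<open>|V - C| + 1\<close> polynomials in \<open>K[V - C]\<close> are
  algebraically dependent by a dimension count.
\<close>

section \<open>Prime chains in quotient rings\<close>

text \<open>Elements of the quotient are cosets, so \<open>\<Union> J\<close> is the preimage of
  \<open>J\<close> under the canonical projection, and preimages of primes under ring homomorphisms
  are prime.\<close>

lemma (in cring) primeideal_Union_quot:
  assumes I: "ideal I R" and J: "primeideal J (R Quot I)"
  shows "primeideal (\<Union> J) R"
proof -
  have Jideal: "ideal J (R Quot I)"
    using J by (simp add: primeideal_def)
  have "\<Union> J = {r \<in> carrier R. I +> r \<in> J}"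
    using canonical_proj_vimage_in_carrier[OF I, of J]
          canonical_proj_vimage_mem_iff[OF I, of J]
          additive_subgroup.a_subset[OF ideal.axioms(1)[OF Jideal]] by blast
  then show ?thesis
    using ring_hom_ring.primeideal_vimage[OF ideal.rcos_ring_hom_ring[OF I] is_cring J] by simp
qed

text \<open>An ideal that contains \<open>I\<close> is a union of cosets of \<open>I\<close>, so
  whether a coset lies in the image can be tested on any representative. Properness and primality
  then descend from \<open>P\<close>.\<close>

lemma (in cring) primeideal_image_quot:
  assumes I: "ideal I R" and P: "primeideal P R" and IP: "I \<subseteq> P"
  shows "primeideal ((+>) I ` P) (R Quot I)"
proof (rule primeidealI)
  have Pideal: "ideal P R" using P by (simp add: primeideal_def)
  show ideal: "ideal ((+>) I ` P) (R Quot I)"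
    by (rule ring_ideal_imp_quot_ideal[OF I Pideal])
  show "cring (R Quot I)"
    by (rule ideal.quotient_is_cring[OF I is_cring])
  have sub: "(+>) I ` P \<subseteq> carrier (R Quot I)"
    by (rule additive_subgroup.a_subset[OF ideal.axioms(1)[OF ideal]])
  have "\<Union> ((+>) I ` P) = P"
    using ideal_incl_iff[OF I Pideal] IP by simp
  then have mem: "I +> a \<in> (+>) I ` P \<longleftrightarrow> a \<in> P" if "a \<in> carrier R" for a
    using canonical_proj_vimage_mem_iff[OF I sub that] by simp
  have car: "carrier (R Quot I) = (+>) I ` carrier R"
    unfolding FactRing_def A_RCOSETS_def'[of R I] by auto
  have "P \<subseteq> carrier R" by (rule additive_subgroup.a_subset[OF ideal.axioms(1)[OF Pideal]])
  then obtain x where "x \<in> carrier R" "x \<notin> P"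
    using primeideal.I_notcarr[OF P] by blast
  then have "I +> x \<in> carrier (R Quot I)" "I +> x \<notin> (+>) I ` P"
    using mem by (simp_all add: car)
  then show "carrier (R Quot I) \<noteq> (+>) I ` P" by metis
  fix a b assume "a \<in> carrier (R Quot I)" "b \<in> carrier (R Quot I)"
    and ab: "a \<otimes>\<^bsub>R Quot I\<^esub> b \<in> (+>) I ` P"
  then obtain x y where xy: "x \<in> carrier R" "a = I +> x" "y \<in> carrier R" "b = I +> y"
    unfolding car by (elim imageE) simp
  then have "a \<otimes>\<^bsub>R Quot I\<^esub> b = I +> (x \<otimes> y)"
    using ideal.rcoset_mult_add[OF I] unfolding FactRing_def by simp
  then have "x \<otimes> y \<in> P" using ab mem xy by simp
  then have "x \<in> P \<or> y \<in> P" using primeideal.I_prime[OF P] xy by blast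
  then show "a \<in> (+>) I ` P \<or> b \<in> (+>) I ` P" using mem xy by simp
qed

text \<open>Union and image are mutually inverse between primes of the quotient and primes
  containing \<open>I\<close>, hence preserve strict inclusions. The Krull dimension of an edge ring
  can thus be computed inside the polynomial ring.\<close>

lemma (in cring) prime_chain_quot_iff:
  assumes I: "ideal I R"
  shows "(\<exists>P. (\<forall>i\<le>n. primeideal (P i) (R Quot I)) \<and> (\<forall>i<n. P i \<subset> P (Suc i)))
     \<longleftrightarrow> (\<exists>P. (\<forall>i\<le>n. primeideal (P i) R \<and> I \<subseteq> P i) \<and> (\<forall>i<n. P i \<subset> P (Suc i)))"
    (is "?L \<longleftrightarrow> ?R")
proof
  have bij: "bij_betw (\<lambda>J. (+>) I ` J) {J. ideal J R \<and> I \<subseteq> J} {J. ideal J (R Quot I)}"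
    by (rule quot_ideal_correspondence[OF I])
  have pi: "ideal J R" if "primeideal J R" for J
    using that by (simp add: primeideal_def)
  {
    assume ?L
    then obtain P where P: "\<And>i. i \<le> n \<Longrightarrow> primeideal (P i) (R Quot I)"
      and chain: "\<And>i. i < n \<Longrightarrow> P i \<subset> P (Suc i)" by blast
    \<comment> \<open>Surjectivity of the ideal correspondence writes \<open>P i\<close> as the
      image of an ideal \<open>J\<close> containing \<open>I\<close>; such a \<open>J\<close> is
      recovered as the union of its cosets.\<close>
    have preim: "I \<subseteq> \<Union> (P i)" "(+>) I ` \<Union> (P i) = P i" if "i \<le> n" for i
    proof -
      have "P i \<in> {J. ideal J (R Quot I)}" using P[OF that] by (simp add: primeideal_def)
      then have "P i \<in> (\<lambda>J. (+>) I ` J) ` {J. ideal J R \<and> I \<subseteq> J}"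
        using bij_betw_imp_surj_on[OF bij] by simp
      then obtain J where "P i = (+>) I ` J" "J \<in> {J. ideal J R \<and> I \<subseteq> J}"
        by (rule imageE)
      then have J: "ideal J R" "I \<subseteq> J" "P i = (+>) I ` J" by simp_all
      have "\<Union> (P i) = J" using J(2) ideal_incl_iff[OF I J(1)] by (simp add: J(3))
      then show "I \<subseteq> \<Union> (P i)" "(+>) I ` \<Union> (P i) = P i" using J(2,3) by simp_all
    qed
    have "\<Union> (P i) \<subset> \<Union> (P (Suc i))" if i: "i < n" for i
    proof
      show "\<Union> (P i) \<subseteq> \<Union> (P (Suc i))"
        by (rule Union_mono) (use chain[OF i] in \<open>simp add: psubset_eq\<close>)
      show "\<Union> (P i) \<noteq> \<Union> (P (Suc i))"
      proof
        assume eq: "\<Union> (P i) = \<Union> (P (Suc i))"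
        have "P i = (+>) I ` \<Union> (P i)" using preim(2)[of i] i by simp
        also have "\<dots> = P (Suc i)" unfolding eq using preim(2)[of "Suc i"] i by simp
        finally show False using chain[OF i] by simp
      qed
    qed
    then show ?R
      using primeideal_Union_quot[OF I P] preim by (intro exI[of _ "\<lambda>i. \<Union> (P i)"]) simp
  next
    assume ?R
    then obtain P where P: "\<And>i. i \<le> n \<Longrightarrow> primeideal (P i) R \<and> I \<subseteq> P i"
      and chain: "\<And>i. i < n \<Longrightarrow> P i \<subset> P (Suc i)" by blast
    have Union: "\<Union> ((+>) I ` P i) = P i" if "i \<le> n" for i
      using ideal_incl_iff[OF I pi, of "P i"] P[OF that] by simp
    have "(+>) I ` P i \<subset> (+>) I ` P (Suc i)" if i: "i < n" for i
    proof
      show "(+>) I ` P i \<subseteq> (+>) I ` P (Suc i)"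
        by (rule image_mono) (use chain[OF i] in \<open>simp add: psubset_eq\<close>)
      show "(+>) I ` P i \<noteq> (+>) I ` P (Suc i)"
      proof
        assume eq: "(+>) I ` P i = (+>) I ` P (Suc i)"
        have "P i = \<Union> ((+>) I ` P i)" using Union[of i] i by simp
        also have "\<dots> = P (Suc i)" unfolding eq using Union[of "Suc i"] i by simp
        finally show False using chain[OF i] by simp
      qed
    qed
    then show ?L
      using primeideal_image_quot[OF I] P by (intro exI[of _ "\<lambda>i. (+>) I ` P i"]) simp
  }
qed

section \<open>Ideals of polynomial rings\<close>

text \<open>Only the carrier depends on \<open>V\<close>. With the operations unfolded, calculations
  take place in the ambient polynomial type and memberships are tracked separately.\<close>

lemma mpoly_ring_simps [simp]:
  "mult (mpoly_ring V) = (*)" "one (mpoly_ring V) = 1"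
  "zero (mpoly_ring V) = 0" "add (mpoly_ring V) = (+)"
  by (simp_all add: mpoly_ring_def)

lemma carrier_mpoly_ring_iff:
  "p \<in> carrier (mpoly_ring V) \<longleftrightarrow> (\<forall>m\<in>Poly_Mapping.keys p. Poly_Mapping.keys m \<subseteq> V)"
  by (simp add: mpoly_ring_def)

lemma carrier_mpoly_ring_mono:
  "V \<subseteq> W \<Longrightarrow> carrier (mpoly_ring V) \<subseteq> carrier (mpoly_ring W)"
  unfolding carrier_mpoly_ring_iff subset_iff by blast

lemma single_in_mpoly_ring: "Poly_Mapping.keys m \<subseteq> V \<Longrightarrow> Poly_Mapping.single m c \<in> carrier (mpoly_ring V)"
  by (auto simp: carrier_mpoly_ring_iff split: if_splits)

lemma mconst_in_mpoly_ring [simp]: "mconst c \<in> carrier (mpoly_ring V)"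
  by (simp add: mconst_def single_in_mpoly_ring)

lemma mvar_in_mpoly_ring [simp]: "mvar v \<in> carrier (mpoly_ring V) \<longleftrightarrow> v \<in> V"
  by (auto simp: mvar_def carrier_mpoly_ring_iff)

lemma mpoly_ring_add [intro]:
  assumes "p \<in> carrier (mpoly_ring V)" "q \<in> carrier (mpoly_ring V)"
  shows "p + q \<in> carrier (mpoly_ring V)"
  using cring.cring_simprules(1)[OF mpoly_ring_cring assms] by simp

lemma mpoly_ring_mult [intro]:
  assumes "p \<in> carrier (mpoly_ring V)" "q \<in> carrier (mpoly_ring V)"
  shows "p * q \<in> carrier (mpoly_ring V)"
  using cring.cring_simprules(5)[OF mpoly_ring_cring assms] by simp

lemma mpoly_ring_0 [simp]: "0 \<in> carrier (mpoly_ring V)"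
  by (simp add: carrier_mpoly_ring_iff)

lemma mpoly_ring_1 [simp]: "1 \<in> carrier (mpoly_ring V)"
  using cring.cring_simprules(6)[OF mpoly_ring_cring, of V] by simp

lemma mpoly_ring_uminus [intro]:
  "p \<in> carrier (mpoly_ring V) \<Longrightarrow> - p \<in> carrier (mpoly_ring V)"
  by (simp add: carrier_mpoly_ring_iff in_keys_iff)

lemma mpoly_ring_power [intro]:
  "p \<in> carrier (mpoly_ring V) \<Longrightarrow> p ^ n \<in> carrier (mpoly_ring V)"
  by (induction n) auto

lemma mpoly_ring_sum [intro]:
  "(\<And>i. i \<in> A \<Longrightarrow> f i \<in> carrier (mpoly_ring V)) \<Longrightarrow> sum f A \<in> carrier (mpoly_ring V)"
  by (induction A rule: infinite_finite_induct) auto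

lemma mpoly_ring_nat_pow [simp]:
  "p [^]\<^bsub>mpoly_ring V\<^esub> (n::nat) = p ^ n"
proof (induction n)
  case 0
  then show ?case by (simp add: nat_pow_def)
next
  case (Suc n)
  then show ?case by (simp add: nat_pow_def mult.commute)
qed

lemma mpoly_ideal_sub_carrier:
  "ideal I (mpoly_ring V) \<Longrightarrow> p \<in> I \<Longrightarrow> p \<in> carrier (mpoly_ring V)"
  by (simp add: ideal.Icarr)

lemma mpoly_ideal_add:
  assumes "ideal I (mpoly_ring V)" "p \<in> I" "q \<in> I"
  shows "p + q \<in> I"
  using additive_subgroup.a_closed[OF ideal.axioms(1)[OF assms(1)] assms(2,3)] by simp

lemma mpoly_ideal_mult:
  assumes "ideal I (mpoly_ring V)" "p \<in> I" "q \<in> carrier (mpoly_ring V)"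
  shows "q * p \<in> I" "p * q \<in> I"
  using ideal.I_l_closed[OF assms] ideal.I_r_closed[OF assms] by simp_all

lemma mpoly_ideal_0: "ideal I (mpoly_ring V) \<Longrightarrow> 0 \<in> I"
  using additive_subgroup.zero_closed[OF ideal.axioms(1), of I "mpoly_ring V"] by simp

lemma mpoly_ideal_diff:
  assumes "ideal I (mpoly_ring V)" "p \<in> I" "q \<in> I"
  shows "p - q \<in> I"
proof -
  have "(- 1) * q \<in> I"
    using assms by (intro mpoly_ideal_mult(1)[of I V]) auto
  then show ?thesis using mpoly_ideal_add[OF assms(1,2), of "- q"] by simp
qed

lemma mpoly_ideal_sum:
  assumes "ideal I (mpoly_ring V)" "\<And>i. i \<in> A \<Longrightarrow> f i \<in> I"
  shows "sum f A \<in> I"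
  using assms(2)
  by (induction A rule: infinite_finite_induct)
     (auto intro: mpoly_ideal_0[OF assms(1)] mpoly_ideal_add[OF assms(1)])

lemma mpoly_ideal_power:
  assumes "ideal I (mpoly_ring V)" "p \<in> I" "0 < n"
  shows "p ^ n \<in> I"
proof -
  obtain k where n: "n = Suc k" using assms(3) gr0_implies_Suc by blast
  have "p ^ k \<in> carrier (mpoly_ring V)"
    using mpoly_ideal_sub_carrier[OF assms(1,2)] by auto
  then show ?thesis using mpoly_ideal_mult(2)[OF assms(1,2)] n by simp
qed

lemma mpoly_primeideal_ideal: "primeideal P (mpoly_ring V) \<Longrightarrow> ideal P (mpoly_ring V)"
  by (simp add: primeideal_def)

lemma mpoly_primeideal_mult:
  assumes "primeideal P (mpoly_ring V)" "p * q \<in> P"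
    "p \<in> carrier (mpoly_ring V)" "q \<in> carrier (mpoly_ring V)"
  shows "p \<in> P \<or> q \<in> P"
  using primeideal.I_prime[OF assms(1,3,4)] assms(2) by simp

lemma mpoly_primeideal_1:
  assumes "primeideal P (mpoly_ring V)"
  shows "1 \<notin> P"
  using primeideal.I_notcarr[OF assms] ideal.one_imp_carrier[OF mpoly_primeideal_ideal[OF assms]]
  by auto

lemma mpoly_primeideal_power:
  assumes "primeideal P (mpoly_ring V)" "p \<in> carrier (mpoly_ring V)" "p ^ n \<in> P"
  shows "p \<in> P"
  using assms(3)
proof (induction n)
  case 0
  then show ?case using mpoly_primeideal_1[OF assms(1)] by simp
next
  case (Suc n)
  then show ?case using mpoly_primeideal_mult[OF assms(1), of p "p ^ n"] assms(2) by auto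
qed

lemma mconst_mult: "mconst (a * b) = mconst a * mconst b"
  by (simp add: mconst_def mult_single)

lemma mconst_0 [simp]: "mconst 0 = 0" and mconst_1 [simp]: "mconst 1 = 1"
  by (simp_all add: mconst_def)

lemma mconst_add: "mconst (a + b) = mconst a + mconst b"
  by (simp add: mconst_def single_add)

text \<open>A nonzero constant is a unit, and a prime ideal is proper.\<close>

lemma mconst_in_primeideal:
  assumes "primeideal P (mpoly_ring V)" "mconst c \<in> P"
  shows "c = 0"
proof (rule ccontr)
  assume "c \<noteq> 0"
  then have "mconst (inverse c) * mconst c = (1 :: ('a, 'b) mpoly)"
    by (simp flip: mconst_mult)
  then show False
    using mpoly_ideal_mult(1)[OF mpoly_primeideal_ideal[OF assms(1)] assms(2), of "mconst (inverse c)"]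
      mpoly_primeideal_1[OF assms(1)] by simp
qed

section \<open>Monomial expansions, ideals generated by variables, and radicals\<close>

lemma poly_mapping_sum_single:
  fixes p :: "'a \<Rightarrow>\<^sub>0 'b::comm_monoid_add"
  shows "p = (\<Sum>m\<in>Poly_Mapping.keys p. Poly_Mapping.single m (Poly_Mapping.lookup p m))"
  by (rule poly_mapping_eqI) (auto simp: lookup_sum lookup_single when_def in_keys_iff)

text \<open>For \<open>W \<subseteq> V\<close> this is the ideal generated by the variables in
  \<open>W\<close>. The description by monomials makes membership a condition on the support, which
  suits the proof of primality.\<close>

definition var_ideal :: "'v set \<Rightarrow> 'v set \<Rightarrow> ('v, 'k::field) mpoly set" where
  "var_ideal V W =
     {p \<in> carrier (mpoly_ring V). \<forall>m\<in>Poly_Mapping.keys p. Poly_Mapping.keys m \<inter> W \<noteq> {}}"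

lemma mvar_in_var_ideal: "mvar v \<in> var_ideal V W \<longleftrightarrow> v \<in> V \<and> v \<in> W"
  by (auto simp: var_ideal_def) (auto simp: mvar_def)

text \<open>Natural number exponents cannot cancel, so equality holds and not just
  inclusion.\<close>

lemma keys_add_nat:
  fixes a b :: "'v \<Rightarrow>\<^sub>0 nat"
  shows "Poly_Mapping.keys (a + b) = Poly_Mapping.keys a \<union> Poly_Mapping.keys b"
  by (auto simp: in_keys_iff lookup_add)

lemma var_ideal_mult:
  assumes "p \<in> var_ideal V W" "q \<in> carrier (mpoly_ring V)"
  shows "q * p \<in> var_ideal V W"
proof -
  have "Poly_Mapping.keys m \<inter> W \<noteq> {}" if m: "m \<in> Poly_Mapping.keys (q * p)" for m
  proof -
    obtain a b where "m = a + b" "b \<in> Poly_Mapping.keys p"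
      using m keys_mult[of q p] by blast
    then show ?thesis using assms(1) by (auto simp: var_ideal_def keys_add_nat)
  qed
  then show ?thesis using assms by (auto simp: var_ideal_def)
qed

text \<open>Additive inverses arise by multiplying with \<open>- 1\<close>, and multiples on the
  other side by commutativity.\<close>

lemma mpoly_idealI:
  fixes I :: "('v, 'k::field) mpoly set"
  assumes carrier: "I \<subseteq> carrier (mpoly_ring V)" and zero: "0 \<in> I"
    and add: "\<And>p q. p \<in> I \<Longrightarrow> q \<in> I \<Longrightarrow> p + q \<in> I"
    and mult: "\<And>p q. p \<in> I \<Longrightarrow> q \<in> carrier (mpoly_ring V) \<Longrightarrow> q * p \<in> I"
  shows "ideal I (mpoly_ring V)"
proof -
  interpret cring "mpoly_ring V :: ('v, 'k) mpoly ring" by (rule mpoly_ring_cring)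
  show ?thesis
  proof (rule idealI)
    show "ring (mpoly_ring V :: ('v, 'k) mpoly ring)" by (rule ring_axioms)
    show "subgroup I (add_monoid (mpoly_ring V))"
    proof (rule add.subgroupI)
      show "I \<subseteq> carrier (mpoly_ring V)" by (rule carrier)
      show "I \<noteq> {}" using zero by blast
      show "p \<oplus>\<^bsub>mpoly_ring V\<^esub> q \<in> I" if "p \<in> I" "q \<in> I" for p q
        using add[OF that] by simp
      show "\<ominus>\<^bsub>mpoly_ring V\<^esub> p \<in> I" if "p \<in> I" for p
      proof -
        have p: "p \<in> carrier (mpoly_ring V)" using carrier that by blast
        then have "\<ominus>\<^bsub>mpoly_ring V\<^esub> p = - p"
          using mpoly_ring_uminus[OF p] minus_equality[of "- p" p] by simp
        moreover have "- 1 \<in> carrier (mpoly_ring V :: ('v, 'k) mpoly ring)"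
          by (rule mpoly_ring_uminus[OF mpoly_ring_1])
        then have "- p \<in> I" using mult[OF that, of "- 1"] by simp
        ultimately show ?thesis by simp
      qed
    qed
    show "x \<otimes>\<^bsub>mpoly_ring V\<^esub> a \<in> I" if "a \<in> I" "x \<in> carrier (mpoly_ring V)" for a x
      using mult[OF that] by simp
    show "a \<otimes>\<^bsub>mpoly_ring V\<^esub> x \<in> I" if "a \<in> I" "x \<in> carrier (mpoly_ring V)" for a x
      using mult[OF that] by (simp add: mult.commute)
  qed
qed

lemma var_ideal_ideal: "ideal (var_ideal V W :: ('v, 'k::field) mpoly set) (mpoly_ring V)"
proof (rule mpoly_idealI)
  show "p + q \<in> var_ideal V W" if "p \<in> var_ideal V W" "q \<in> var_ideal V W" for p q :: "('v, 'k) mpoly"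
    using that Poly_Mapping.keys_add[of p q] by (auto simp: var_ideal_def)
  show "var_ideal V W \<subseteq> carrier (mpoly_ring V)" and "0 \<in> var_ideal V W"
    by (auto simp: var_ideal_def)
qed (rule var_ideal_mult)

text \<open>Contraction to the subring on fewer variables. It serves to compare an ideal generated
  in the ring of one \<open>Gs i\<close> with an ideal in the ring of \<open>G\<close>.\<close>

lemma mpoly_ideal_restrict:
  assumes J: "ideal J (mpoly_ring V)" and U: "U \<subseteq> V"
  shows "ideal (J \<inter> carrier (mpoly_ring U)) (mpoly_ring U)"
proof (rule mpoly_idealI)
  show "q * p \<in> J \<inter> carrier (mpoly_ring U)"
    if "p \<in> J \<inter> carrier (mpoly_ring U)" "q \<in> carrier (mpoly_ring U)" for p q
    using that mpoly_ideal_mult(1)[OF J, of p q] carrier_mpoly_ring_mono[OF U] by auto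
qed (use mpoly_ideal_0[OF J] mpoly_ideal_add[OF J] in auto)

lemma mpoly_ring_of_nat: "of_nat n \<in> carrier (mpoly_ring V)"
  by (induction n) auto

text \<open>For sums, every term of the binomial expansion of \<open>(p + q) ^ (n + m)\<close>
  contains \<open>p ^ n\<close> or \<open>q ^ m\<close> as a factor.\<close>

lemma radical_ideal:
  assumes I: "ideal I (mpoly_ring V)"
  shows "ideal (radical (mpoly_ring V) I) (mpoly_ring V)"
proof (rule mpoly_idealI)
  show "radical (mpoly_ring V) I \<subseteq> carrier (mpoly_ring V)" by (auto simp: radical_def)
  show "0 \<in> radical (mpoly_ring V) I"
    using mpoly_ideal_0[OF I] by (auto simp: radical_def intro!: exI[of _ 1])
  show "q * p \<in> radical (mpoly_ring V) I"
    if p: "p \<in> radical (mpoly_ring V) I" and q: "q \<in> carrier (mpoly_ring V)" for p q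
  proof -
    obtain n where n: "p \<in> carrier (mpoly_ring V)" "0 < n" "p ^ n \<in> I"
      using p by (auto simp: radical_def)
    have "(q * p) ^ n \<in> I"
      unfolding power_mult_distrib by (rule mpoly_ideal_mult(1)[OF I n(3) mpoly_ring_power[OF q]])
    then show ?thesis using n q by (auto simp: radical_def)
  qed
  show "p + q \<in> radical (mpoly_ring V) I"
    if p: "p \<in> radical (mpoly_ring V) I" and q: "q \<in> radical (mpoly_ring V) I" for p q
  proof -
    obtain n where n: "p \<in> carrier (mpoly_ring V)" "0 < n" "p ^ n \<in> I"
      using p by (auto simp: radical_def)
    obtain m where m: "q \<in> carrier (mpoly_ring V)" "0 < m" "q ^ m \<in> I"
      using q by (auto simp: radical_def)
    have "of_nat (n + m choose k) * p ^ k * q ^ (n + m - k) \<in> I" for k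
    proof (cases "n \<le> k")
      case True
      then have "p ^ k = p ^ (k - n) * p ^ n" by (simp flip: power_add)
      then have "of_nat (n + m choose k) * p ^ k * q ^ (n + m - k)
          = of_nat (n + m choose k) * p ^ (k - n) * q ^ (n + m - k) * p ^ n"
        by (simp add: mult_ac)
      also have "\<dots> \<in> I"
        by (intro mpoly_ideal_mult(1)[OF I n(3)] mpoly_ring_mult mpoly_ring_power n m mpoly_ring_of_nat)
      finally show ?thesis .
    next
      case False
      then have "q ^ (n + m - k) = q ^ (n - k) * q ^ m" by (simp flip: power_add)
      then have "of_nat (n + m choose k) * p ^ k * q ^ (n + m - k)
          = of_nat (n + m choose k) * p ^ k * q ^ (n - k) * q ^ m"
        by (simp add: mult_ac)
      also have "\<dots> \<in> I"
        by (intro mpoly_ideal_mult(1)[OF I m(3)] mpoly_ring_mult mpoly_ring_power n m mpoly_ring_of_nat)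
      finally show ?thesis .
    qed
    then have "(p + q) ^ (n + m) \<in> I"
      unfolding binomial_ring by (rule mpoly_ideal_sum[OF I])
    then show ?thesis using n m by (auto simp: radical_def intro!: exI[of _ "n + m"])
  qed
qed

text \<open>Each monomial of an element is a multiple of some variable in \<open>W\<close>, and the
  element is the sum of its monomial terms.\<close>

lemma var_ideal_subset:
  fixes I :: "('v, 'k::field) mpoly set"
  assumes I: "ideal I (mpoly_ring V)" and W: "\<And>v. v \<in> W \<Longrightarrow> v \<in> V \<Longrightarrow> mvar v \<in> I"
  shows "var_ideal V W \<subseteq> I"
proof
  fix p :: "('v, 'k) mpoly" assume p: "p \<in> var_ideal V W"
  have "Poly_Mapping.single m (Poly_Mapping.lookup p m) \<in> I" if m: "m \<in> Poly_Mapping.keys p" for m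
  proof -
    have mV: "Poly_Mapping.keys m \<subseteq> V"
      using p m by (auto simp: var_ideal_def carrier_mpoly_ring_iff)
    obtain v where v: "v \<in> Poly_Mapping.keys m" "v \<in> W"
      using p m by (auto simp: var_ideal_def)
    \<comment> \<open>Division of the monomial by \<open>v\<close>: the exponent of \<open>v\<close>
      is positive, so the truncated subtraction loses nothing.\<close>
    define m' where "m' = m - Poly_Mapping.single v 1"
    have "m = m' + Poly_Mapping.single v 1"
      using v by (intro poly_mapping_eqI)
        (auto simp: m'_def lookup_add lookup_minus lookup_single when_def in_keys_iff)
    then have "Poly_Mapping.single m (Poly_Mapping.lookup p m)
        = Poly_Mapping.single m' (Poly_Mapping.lookup p m) * mvar v"
      by (simp add: mvar_def mult_single)
    moreover have "Poly_Mapping.keys m' \<subseteq> V"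
      using mV by (auto simp: m'_def in_keys_iff lookup_minus)
    moreover have "mvar v \<in> I" using W v mV by blast
    ultimately show ?thesis
      by (simp add: mpoly_ideal_mult(1)[OF I] single_in_mpoly_ring)
  qed
  then show "p \<in> I"
    by (subst poly_mapping_sum_single) (rule mpoly_ideal_sum[OF I])
qed

text \<open>Minimality of the generated ideal gives one inclusion, \<open>var_ideal_subset\<close>
  the other.\<close>

lemma genideal_mvar:
  assumes "W \<subseteq> V"
  shows "genideal (mpoly_ring V) (mvar ` W) = (var_ideal V W :: ('v, 'k::field) mpoly set)"
proof -
  interpret cring "mpoly_ring V :: ('v, 'k) mpoly ring" by (rule mpoly_ring_cring)
  have car: "mvar ` W \<subseteq> carrier (mpoly_ring V :: ('v, 'k) mpoly ring)" using assms by auto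
  show ?thesis
  proof
    show "genideal (mpoly_ring V) (mvar ` W) \<subseteq> (var_ideal V W :: ('v, 'k) mpoly set)"
      using assms by (intro genideal_minimal var_ideal_ideal) (auto simp: mvar_in_var_ideal)
    show "var_ideal V W \<subseteq> (genideal (mpoly_ring V) (mvar ` W) :: ('v, 'k) mpoly set)"
      using genideal_self[OF car] by (intro var_ideal_subset genideal_ideal[OF car]) auto
  qed
qed

text \<open>This stands in for leading monomials: maximising one exponent after another, as in a
  lexicographic order, leaves a pair whose sum is attained only once. The corresponding coefficient
  of a product cannot cancel.\<close>

lemma unique_sum_of_monomials:
  fixes A B :: "('v \<Rightarrow>\<^sub>0 nat) set"
  assumes "finite V" "finite A" "A \<noteq> {}" "finite B" "B \<noteq> {}"
    "\<And>a. a \<in> A \<union> B \<Longrightarrow> Poly_Mapping.keys a \<subseteq> V"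
  shows "\<exists>a\<in>A. \<exists>b\<in>B. \<forall>a'\<in>A. \<forall>b'\<in>B. a' + b' = a + b \<longrightarrow> a' = a \<and> b' = b"
proof -
  \<comment> \<open>The support condition is weakened for the induction: within \<open>A\<close>,
    and within \<open>B\<close>, exponents on \<open>V\<close> need only tell the monomials apart.
    For empty \<open>V\<close> both sets are then singletons.\<close>
  have "\<exists>a\<in>A. \<exists>b\<in>B. \<forall>a'\<in>A. \<forall>b'\<in>B. a' + b' = a + b \<longrightarrow> a' = a \<and> b' = b"
    if "finite V" "finite A" "A \<noteq> {}" "finite B" "B \<noteq> {}"
      "\<And>a a'. a \<in> A \<Longrightarrow> a' \<in> A \<Longrightarrow> (\<And>v. v \<in> V \<Longrightarrow> Poly_Mapping.lookup a v = Poly_Mapping.lookup a' v) \<Longrightarrow> a = a'"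
      "\<And>a a'. a \<in> B \<Longrightarrow> a' \<in> B \<Longrightarrow> (\<And>v. v \<in> V \<Longrightarrow> Poly_Mapping.lookup a v = Poly_Mapping.lookup a' v) \<Longrightarrow> a = a'"
    for A B :: "('v \<Rightarrow>\<^sub>0 nat) set"
    using that
  proof (induction V arbitrary: A B rule: finite_induct)
    case empty
    then show ?case by (metis all_not_in_conv)
  next
    case (insert v V)
    \<comment> \<open>\<open>S X\<close> keeps the elements of \<open>X\<close> whose exponent of
      \<open>v\<close> is maximal. That exponent is constant on \<open>S X\<close>, so the remaining
      variables still tell its elements apart.\<close>
    define top where "top S = Max ((\<lambda>a. Poly_Mapping.lookup a v) ` S)" for S :: "('v \<Rightarrow>\<^sub>0 nat) set"
    define S where "S X = {a\<in>X. Poly_Mapping.lookup a v = top X}" for X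
    have S: "finite (S X)" "S X \<noteq> {}" "\<And>a. a \<in> X \<Longrightarrow> Poly_Mapping.lookup a v \<le> top X"
      if "finite X" "X \<noteq> {}" for X
    proof -
      have "top X \<in> (\<lambda>a. Poly_Mapping.lookup a v) ` X"
        unfolding top_def using that by (intro Max_in) auto
      then show "S X \<noteq> {}" by (auto simp: S_def)
    qed (use that in \<open>auto simp: S_def top_def\<close>)
    have "\<exists>a\<in>S A. \<exists>b\<in>S B. \<forall>a'\<in>S A. \<forall>b'\<in>S B. a' + b' = a + b \<longrightarrow> a' = a \<and> b' = b"
    proof (rule insert.IH)
      show "a = a'" if "a \<in> S A" "a' \<in> S A"
        "\<And>v. v \<in> V \<Longrightarrow> Poly_Mapping.lookup a v = Poly_Mapping.lookup a' v" for a a'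
        using that by (intro insert.prems(5)) (auto simp: S_def)
      show "a = a'" if "a \<in> S B" "a' \<in> S B"
        "\<And>v. v \<in> V \<Longrightarrow> Poly_Mapping.lookup a v = Poly_Mapping.lookup a' v" for a a'
        using that by (intro insert.prems(6)) (auto simp: S_def)
    qed (use S insert.prems in auto)
    then obtain a b where ab: "a \<in> S A" "b \<in> S B"
      "\<And>a' b'. a' \<in> S A \<Longrightarrow> b' \<in> S B \<Longrightarrow> a' + b' = a + b \<Longrightarrow> a' = a \<and> b' = b" by blast
    have "a' = a \<and> b' = b" if "a' \<in> A" "b' \<in> B" "a' + b' = a + b" for a' b'
    proof -
      \<comment> \<open>Two exponents bounded by the maxima can add up to the sum of the maxima only
        if both are maximal; so \<open>a'\<close> and \<open>b'\<close> lie in the selected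
        subsets.\<close>
      have "Poly_Mapping.lookup a' v + Poly_Mapping.lookup b' v = top A + top B"
        using ab(1,2) that(3) by (metis (mono_tags, lifting) S_def lookup_add mem_Collect_eq)
      then have "Poly_Mapping.lookup a' v = top A" "Poly_Mapping.lookup b' v = top B"
        using S(3)[of A a'] S(3)[of B b'] that insert.prems by force+
      then show ?thesis using ab(3) that by (simp add: S_def)
    qed
    then show ?case using ab(1,2) by (auto simp: S_def)
  qed
  moreover have "a = a'"
    if "a \<in> A \<union> B" "a' \<in> A \<union> B" and eq: "\<And>v. v \<in> V \<Longrightarrow> Poly_Mapping.lookup a v = Poly_Mapping.lookup a' v" for a a'
  proof (rule poly_mapping_eqI)
    show "Poly_Mapping.lookup a v = Poly_Mapping.lookup a' v" for v
      using assms(6)[OF that(1)] assms(6)[OF that(2)] eq[of v]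
      by (cases "v \<in> V") (simp, metis in_keys_iff subset_iff)
  qed
  ultimately show ?thesis
    using assms(1-5) by simp
qed

lemma lookup_mult_keys:
  fixes p q :: "('v, 'k::field) mpoly"
  shows "Poly_Mapping.lookup (p * q) m =
    (\<Sum>(a, b)\<in>Poly_Mapping.keys p \<times> Poly_Mapping.keys q.
       if a + b = m then Poly_Mapping.lookup p a * Poly_Mapping.lookup q b else 0)"
proof -
  have "p * q = (\<Sum>a\<in>Poly_Mapping.keys p. Poly_Mapping.single a (Poly_Mapping.lookup p a)) *
      (\<Sum>b\<in>Poly_Mapping.keys q. Poly_Mapping.single b (Poly_Mapping.lookup q b))"
    by (simp flip: poly_mapping_sum_single)
  also have "\<dots> = (\<Sum>(a, b)\<in>Poly_Mapping.keys p \<times> Poly_Mapping.keys q.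
      Poly_Mapping.single (a + b) (Poly_Mapping.lookup p a * Poly_Mapping.lookup q b))"
    by (simp add: sum_product sum.cartesian_product mult_single)
  finally show ?thesis
    by (simp add: lookup_sum lookup_single when_def case_prod_unfold)
qed

text \<open>If neither factor lies in the ideal, both have monomials free of \<open>W\<close>. A
  uniquely attained sum of two such monomials survives in the product and is again free of
  \<open>W\<close>.\<close>

lemma var_ideal_primeideal:
  assumes "finite V"
  shows "primeideal (var_ideal V W :: ('v, 'k::field) mpoly set) (mpoly_ring V)"
proof (rule primeidealI[OF var_ideal_ideal mpoly_ring_cring])
  have "(1 :: ('v, 'k) mpoly) \<notin> var_ideal V W"
    by (simp add: var_ideal_def)
  then show "carrier (mpoly_ring V) \<noteq> (var_ideal V W :: ('v, 'k) mpoly set)"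
    using mpoly_ring_1 by blast
next
  fix p q :: "('v, 'k) mpoly"
  assume p: "p \<in> carrier (mpoly_ring V)" and q: "q \<in> carrier (mpoly_ring V)"
    and pq: "p \<otimes>\<^bsub>mpoly_ring V\<^esub> q \<in> var_ideal V W"
  show "p \<in> var_ideal V W \<or> q \<in> var_ideal V W"
  proof (rule ccontr)
    assume contra: "\<not> ?thesis"
    define S where "S r = {m \<in> Poly_Mapping.keys r. Poly_Mapping.keys m \<inter> W = {}}" for r :: "('v, 'k) mpoly"
    have "\<exists>a\<in>S p. \<exists>b\<in>S q. \<forall>a'\<in>S p. \<forall>b'\<in>S q. a' + b' = a + b \<longrightarrow> a' = a \<and> b' = b"
      using contra p q
      by (intro unique_sum_of_monomials[OF assms]) (auto simp: S_def var_ideal_def carrier_mpoly_ring_iff)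
    then obtain a b where ab: "a \<in> S p" "b \<in> S q"
      "\<And>a' b'. a' \<in> S p \<Longrightarrow> b' \<in> S q \<Longrightarrow> a' + b' = a + b \<Longrightarrow> a' = a \<and> b' = b" by blast
    \<comment> \<open>A sum of monomials avoids \<open>W\<close> only if both summands do, so
      uniqueness extends from the \<open>W\<close>-free monomials to all monomials of
      \<open>p\<close> and \<open>q\<close>.\<close>
    have "a' = a \<and> b' = b" if "a' \<in> Poly_Mapping.keys p" "b' \<in> Poly_Mapping.keys q" "a' + b' = a + b" for a' b'
    proof -
      have "Poly_Mapping.keys (a + b) \<inter> W = {}"
        using ab(1,2) by (auto simp: S_def keys_add_nat)
      then have "Poly_Mapping.keys a' \<inter> W = {}" "Poly_Mapping.keys b' \<inter> W = {}"
        unfolding that(3)[symmetric] by (auto simp: keys_add_nat)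
      then show ?thesis using that ab(3)[of a' b'] by (simp add: S_def)
    qed
    then have "Poly_Mapping.lookup (p * q) (a + b) =
      (\<Sum>x\<in>Poly_Mapping.keys p \<times> Poly_Mapping.keys q.
        if x = (a, b) then Poly_Mapping.lookup p a * Poly_Mapping.lookup q b else 0)"
      unfolding lookup_mult_keys case_prod_unfold by (intro sum.cong if_cong) auto
    also have "\<dots> = Poly_Mapping.lookup p a * Poly_Mapping.lookup q b"
      using ab(1,2) by (simp add: S_def)
    also have "\<dots> \<noteq> 0" using ab(1,2) by (simp add: S_def in_keys_iff)
    finally have "a + b \<in> Poly_Mapping.keys (p * q)" by (simp add: in_keys_iff)
    then have "Poly_Mapping.keys (a + b) \<inter> W \<noteq> {}"
      using pq by (simp add: var_ideal_def)
    then show False using ab(1,2) by (auto simp: S_def keys_add_nat)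
  qed
qed

section \<open>Lengths of prime chains\<close>

text \<open>Monomials in the entries of \<open>xs\<close>, with exponents given as a list: an
  algebraic relation becomes a sum over exponent lists, and induction on \<open>xs\<close> strips
  off one element at a time.\<close>

fun power_prod :: "'a::comm_monoid_mult list \<Rightarrow> nat list \<Rightarrow> 'a" where
  "power_prod (x # xs) (a # as) = x ^ a * power_prod xs as"
| "power_prod _ _ = 1"

lemma power_prod_in_mpoly_ring:
  "set xs \<subseteq> carrier (mpoly_ring V) \<Longrightarrow> power_prod xs as \<in> carrier (mpoly_ring V)"
  by (induction xs as rule: power_prod.induct) (auto intro: mpoly_ring_mult mpoly_ring_power)

text \<open>Divide out the least power of the first element that occurs: the relation then moves to
  the next prime of the chain, where the remaining multiples of that element vanish.\<close>

lemma prime_chain_algebraically_independent: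
  fixes P :: "nat \<Rightarrow> ('v, 'k::field) mpoly set"
  assumes "\<And>i. i \<le> length xs \<Longrightarrow> primeideal (P i) (mpoly_ring V)"
    and "\<And>i. i < length xs \<Longrightarrow> P i \<subseteq> P (Suc i)"
    and "\<And>i. i < length xs \<Longrightarrow> xs ! i \<in> P (Suc i) - P i"
    and "finite A" and "A \<subseteq> {as. length as = length xs}"
    and "(\<Sum>as\<in>A. mconst (c as) * power_prod xs as) \<in> P 0"
    and "as \<in> A"
  shows "c as = 0"
  using assms
proof (induction xs arbitrary: P A c as)
  case Nil
  \<comment> \<open>With no elements left, the relation says that a constant lies in
    \<open>P 0\<close>.\<close>
  then have "A = {[]}" by auto
  then show ?case
    using Nil.prems(1)[of 0] Nil.prems(6,7) mconst_in_primeideal by fastforce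
next
  case (Cons x xs)
  have P0: "primeideal (P 0) (mpoly_ring V)" and P1: "primeideal (P 1) (mpoly_ring V)"
    using Cons.prems(1)[of 0] Cons.prems(1)[of 1] by simp_all
  have x: "x \<in> P 1" "x \<notin> P 0" using Cons.prems(3)[of 0] by simp_all
  have xs: "xs ! i \<in> P (Suc (Suc i)) - P (Suc i)" if "i < length xs" for i
    using Cons.prems(3)[of "Suc i"] that by simp
  note I1 = mpoly_primeideal_ideal[OF P1]
  have xcar: "x \<in> carrier (mpoly_ring V)"
    using mpoly_ideal_sub_carrier[OF I1 x(1)] .
  have xscar: "set xs \<subseteq> carrier (mpoly_ring V)"
  proof
    fix y assume "y \<in> set xs"
    then obtain i where i: "i < length xs" "y = xs ! i" by (metis in_set_conv_nth)
    have "ideal (P (Suc (Suc i))) (mpoly_ring V)"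
      using Cons.prems(1)[of "Suc (Suc i)"] i mpoly_primeideal_ideal by simp
    then show "y \<in> carrier (mpoly_ring V)"
      using mpoly_ideal_sub_carrier xs[OF i(1)] i(2) by blast
  qed
  show ?case
  proof (rule ccontr)
    assume "c as \<noteq> 0"
    \<comment> \<open>Restricting to nonzero coefficients ensures that the least exponent
      \<open>m\<close> of \<open>x\<close> is attained by a term that is really present, namely
      \<open>b0\<close>.\<close>
    define B where "B = {as \<in> A. c as \<noteq> 0}"
    have fB: "finite B" and lenB: "\<And>as. as \<in> B \<Longrightarrow> length as = Suc (length xs)" and "as \<in> B"
      using Cons.prems(4,5,7) \<open>c as \<noteq> 0\<close> by (auto simp: B_def)
    define m where "m = Min (hd ` B)"
    have m_le: "m \<le> hd bs" if "bs \<in> B" for bs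
      unfolding m_def using fB that by simp
    have "m \<in> hd ` B" unfolding m_def using fB \<open>as \<in> B\<close> by (intro Min_in) auto
    then obtain b0 where b0: "b0 \<in> B" "hd b0 = m" by auto
    have Cons_form: "bs = hd bs # tl bs" if "bs \<in> B" for bs
      using lenB[OF that] by (cases bs) auto
    let ?t = "\<lambda>bs. mconst (c bs) * (x ^ (hd bs - m) * power_prod xs (tl bs))"
    have tcar: "?t bs \<in> carrier (mpoly_ring V)" for bs
      using xcar power_prod_in_mpoly_ring[OF xscar] by (intro mpoly_ring_mult mpoly_ring_power) auto
    have "(\<Sum>bs\<in>A. mconst (c bs) * power_prod (x # xs) bs) =
        (\<Sum>bs\<in>B. mconst (c bs) * power_prod (x # xs) bs)"
      unfolding B_def using Cons.prems(4) by (intro sum.mono_neutral_right) auto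
    also have "\<dots> = (\<Sum>bs\<in>B. x ^ m * ?t bs)"
    proof (rule sum.cong[OF refl])
      fix bs assume bs: "bs \<in> B"
      have "power_prod (x # xs) bs = x ^ hd bs * power_prod xs (tl bs)"
        by (subst Cons_form[OF bs]) simp
      moreover have "x ^ hd bs = x ^ m * x ^ (hd bs - m)"
        using m_le[OF bs] by (simp flip: power_add)
      ultimately show "mconst (c bs) * power_prod (x # xs) bs = x ^ m * ?t bs"
        by (simp add: mult_ac)
    qed
    also have "\<dots> = x ^ m * (\<Sum>bs\<in>B. ?t bs)" by (simp add: sum_distrib_left)
    finally have "x ^ m * (\<Sum>bs\<in>B. ?t bs) \<in> P 0" using Cons.prems(6) by simp
    moreover have "x ^ m \<notin> P 0" using mpoly_primeideal_power[OF P0 xcar] x by blast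
    moreover have "(\<Sum>bs\<in>B. ?t bs) \<in> carrier (mpoly_ring V)"
      by (rule mpoly_ring_sum) (rule tcar)
    ultimately have "(\<Sum>bs\<in>B. ?t bs) \<in> P 0"
      using mpoly_primeideal_mult[OF P0] mpoly_ring_power[OF xcar] by blast
    then have "(\<Sum>bs\<in>B. ?t bs) \<in> P 1" using Cons.prems(2)[of 0] by auto
    moreover have "(\<Sum>bs\<in>{bs\<in>B. hd bs \<noteq> m}. ?t bs) \<in> P 1"
    proof (rule mpoly_ideal_sum[OF I1])
      fix bs assume "bs \<in> {bs \<in> B. hd bs \<noteq> m}"
      then have "0 < hd bs - m" using m_le[of bs] by force
      then have "x ^ (hd bs - m) \<in> P 1" by (rule mpoly_ideal_power[OF I1 x(1)])
      then show "?t bs \<in> P 1"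
        using power_prod_in_mpoly_ring[OF xscar]
        by (intro mpoly_ideal_mult(1)[OF I1] mpoly_ideal_mult(2)[OF I1]) auto
    qed
    ultimately have "(\<Sum>bs\<in>B. ?t bs) - (\<Sum>bs\<in>{bs\<in>B. hd bs \<noteq> m}. ?t bs) \<in> P 1"
      by (rule mpoly_ideal_diff[OF I1])
    also have "(\<Sum>bs\<in>B. ?t bs) - (\<Sum>bs\<in>{bs\<in>B. hd bs \<noteq> m}. ?t bs) = (\<Sum>bs\<in>{bs\<in>B. hd bs = m}. ?t bs)"
    proof -
      have "{bs\<in>B. hd bs = m} = B - {bs\<in>B. hd bs \<noteq> m}" by auto
      moreover have "sum ?t (B - {bs\<in>B. hd bs \<noteq> m}) = sum ?t B - sum ?t {bs\<in>B. hd bs \<noteq> m}"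
        using fB by (intro sum_diff) auto
      ultimately show ?thesis by simp
    qed
    \<comment> \<open>Among the terms with exponent exactly \<open>m\<close> the power of
      \<open>x\<close> has become 1, leaving a relation in \<open>xs\<close> alone.\<close>
    also have "\<dots> = (\<Sum>cs\<in>{cs. m # cs \<in> B}. mconst (c (m # cs)) * power_prod xs cs)"
      by (rule sum.reindex_bij_witness[of _ "Cons m" tl]) (use Cons_form in force)+
    finally have rel: "(\<Sum>cs\<in>{cs. m # cs \<in> B}. mconst (c (m # cs)) * power_prod xs cs) \<in> P 1" .
    \<comment> \<open>The induction hypothesis for the chain starting at \<open>P 1\<close> kills
      the coefficient of \<open>b0\<close>, which is nonzero by choice.\<close>
    have "c (m # tl b0) = 0"
    proof (rule Cons.IH[of "\<lambda>i. P (Suc i)" "{cs. m # cs \<in> B}" "\<lambda>cs. c (m # cs)"])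
      show "primeideal (P (Suc i)) (mpoly_ring V)" if "i \<le> length xs" for i
        using Cons.prems(1)[of "Suc i"] that by simp
      show "P (Suc i) \<subseteq> P (Suc (Suc i))" if "i < length xs" for i
        using Cons.prems(2)[of "Suc i"] that by simp
      show "xs ! i \<in> P (Suc (Suc i)) - P (Suc i)" if "i < length xs" for i
        by (rule xs[OF that])
      show "finite {cs. m # cs \<in> B}"
        by (rule finite_subset[OF _ finite_imageI[OF fB, of tl]]) force
      show "{cs. m # cs \<in> B} \<subseteq> {as. length as = length xs}"
        using lenB by force
      show "tl b0 \<in> {cs. m # cs \<in> B}" using b0 Cons_form[OF b0(1)] by simp
    qed (use rel in simp)
    moreover have "m # tl b0 = b0" using b0 Cons_form[OF b0(1)] by simp
    ultimately show False using b0(1) by (simp add: B_def)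
  qed
qed

section \<open>Algebraic dependence through vector space dimension\<close>

interpretation mpoly: vector_space "\<lambda>c p. mconst c * (p :: ('v, 'k::field) mpoly)"
  by unfold_locales (simp_all add: distrib_left distrib_right mconst_add mconst_mult mult.assoc)

text \<open>Exponents are bounded separately for each variable and not by total degree: the
  monomials allowed are then easy to count, and the bounds still add under multiplication.\<close>

definition mpoly_box :: "'v set \<Rightarrow> nat \<Rightarrow> ('v, 'k::field) mpoly set" where
  "mpoly_box W d = {p. \<forall>m\<in>Poly_Mapping.keys p. Poly_Mapping.keys m \<subseteq> W \<and> (\<forall>v. Poly_Mapping.lookup m v \<le> d)}"

lemma mpoly_box_mult:
  assumes "p \<in> mpoly_box W d" "q \<in> mpoly_box W e"
  shows "p * q \<in> mpoly_box W (d + e)"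
  unfolding mpoly_box_def
proof (intro CollectI ballI)
  fix m assume "m \<in> Poly_Mapping.keys (p * q)"
  then obtain a b where "m = a + b" "a \<in> Poly_Mapping.keys p" "b \<in> Poly_Mapping.keys q"
    using keys_mult[of p q] by blast
  then show "Poly_Mapping.keys m \<subseteq> W \<and> (\<forall>v. Poly_Mapping.lookup m v \<le> d + e)"
    using assms by (simp add: mpoly_box_def keys_add_nat lookup_add add_mono)
qed

lemma mpoly_box_mono: "d \<le> e \<Longrightarrow> mpoly_box W d \<subseteq> mpoly_box W e"
  unfolding mpoly_box_def using order_trans by blast

lemma mpoly_box_1: "1 \<in> mpoly_box W d"
  by (simp add: mpoly_box_def)

lemma mpoly_box_power: "p \<in> mpoly_box W d \<Longrightarrow> p ^ n \<in> mpoly_box W (n * d)"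
  by (induction n) (simp_all add: mpoly_box_1 mpoly_box_mult)

text \<open>Each factor contributes at most \<open>n * d\<close>. What matters later is that the
  bound is linear in \<open>n\<close>.\<close>

lemma mpoly_box_power_prod:
  assumes "set xs \<subseteq> mpoly_box W d" "\<And>a. a \<in> set as \<Longrightarrow> a \<le> n"
  shows "power_prod xs as \<in> mpoly_box W (length xs * (n * d))"
  using assms
proof (induction xs as rule: power_prod.induct)
  case (1 x xs a as)
  have "x ^ a \<in> mpoly_box W (n * d)"
    using mpoly_box_power[of x W d a] mpoly_box_mono[of "a * d" "n * d" W] 1(2,3) by auto
  then show ?case using mpoly_box_mult 1 by simp
qed (simp_all add: mpoly_box_1)

lemma in_some_mpoly_box:
  assumes "p \<in> carrier (mpoly_ring W)"
  shows "\<exists>d. p \<in> mpoly_box W d"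
proof -
  \<comment> \<open>A crude bound: the sum of all exponents in all monomials of
    \<open>p\<close>.\<close>
  define d where "d = (\<Sum>m\<in>Poly_Mapping.keys p. \<Sum>v\<in>Poly_Mapping.keys m. Poly_Mapping.lookup m v)"
  have "Poly_Mapping.lookup m v \<le> d" if m: "m \<in> Poly_Mapping.keys p" for m v
  proof (cases "v \<in> Poly_Mapping.keys m")
    case True
    then have "Poly_Mapping.lookup m v \<le> (\<Sum>v\<in>Poly_Mapping.keys m. Poly_Mapping.lookup m v)"
      by (intro member_le_sum) auto
    also have "\<dots> \<le> d" unfolding d_def
      using m by (intro member_le_sum[of m _ "\<lambda>m. \<Sum>v\<in>Poly_Mapping.keys m. Poly_Mapping.lookup m v"]) auto
    finally show ?thesis .
  qed (simp add: in_keys_iff)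
  then have "p \<in> mpoly_box W d"
    using assms by (simp add: mpoly_box_def carrier_mpoly_ring_iff)
  then show ?thesis ..
qed

lemma set_in_some_mpoly_box:
  assumes "set xs \<subseteq> carrier (mpoly_ring W)"
  shows "\<exists>d. set xs \<subseteq> mpoly_box W d"
  using assms
proof (induction xs)
  case (Cons x xs)
  then obtain d e where "set xs \<subseteq> mpoly_box W d" "x \<in> mpoly_box W e"
    using in_some_mpoly_box by (metis insert_subset list.simps(15))
  then have "set (x # xs) \<subseteq> mpoly_box W (max d e)"
    using mpoly_box_mono[of d "max d e" W] mpoly_box_mono[of e "max d e" W] by auto
  then show ?case ..
qed simp

text \<open>The monomials in the box span it. They are determined by their exponents on
  \<open>W\<close>, hence inject into the functions from \<open>W\<close> to
  \<open>{..d}\<close>.\<close>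

lemma mpoly_box_spanning:
  assumes "finite W"
  obtains T :: "('v, 'k::field) mpoly set"
  where "finite T" "card T \<le> Suc d ^ card W" "mpoly_box W d \<subseteq> mpoly.span T"
proof -
  define M where "M = {m :: 'v \<Rightarrow>\<^sub>0 nat. Poly_Mapping.keys m \<subseteq> W \<and> (\<forall>v. Poly_Mapping.lookup m v \<le> d)}"
  let ?r = "\<lambda>m. restrict (Poly_Mapping.lookup m) W"
  have inj: "inj_on ?r M"
  proof (rule inj_onI, rule poly_mapping_eqI)
    fix m m' v assume M: "m \<in> M" "m' \<in> M" and eq: "?r m = ?r m'"
    show "Poly_Mapping.lookup m v = Poly_Mapping.lookup m' v"
    proof (cases "v \<in> W")
      case True
      then show ?thesis using fun_cong[OF eq, of v] by simp
    next
      case False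
      then have "v \<notin> Poly_Mapping.keys m" "v \<notin> Poly_Mapping.keys m'" using M by (auto simp: M_def)
      then show ?thesis by (simp add: in_keys_iff)
    qed
  qed
  have im: "?r ` M \<subseteq> (\<Pi>\<^sub>E v\<in>W. {..d})" by (auto simp: M_def)
  have fin: "finite (\<Pi>\<^sub>E v\<in>W. {..d})" using assms by (intro finite_PiE) auto
  have "finite M" using finite_imageD[OF finite_subset[OF im fin] inj] .
  have "card M \<le> card (\<Pi>\<^sub>E v\<in>W. {..d})" by (rule card_inj_on_le[OF inj im fin])
  also have "\<dots> = Suc d ^ card W" using assms by (simp add: card_PiE)
  finally have cM: "card M \<le> Suc d ^ card W" .
  define T where "T = (\<lambda>m. Poly_Mapping.single m (1::'k)) ` M"
  have "mpoly_box W d \<subseteq> mpoly.span T"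
  proof
    fix p :: "('v, 'k) mpoly" assume p: "p \<in> mpoly_box W d"
    have "Poly_Mapping.single m (Poly_Mapping.lookup p m) \<in> mpoly.span T" if "m \<in> Poly_Mapping.keys p" for m
    proof -
      have "m \<in> M" using p that by (simp add: mpoly_box_def M_def)
      then have "mconst (Poly_Mapping.lookup p m) * Poly_Mapping.single m 1 \<in> mpoly.span T"
        by (intro mpoly.span_scale mpoly.span_base) (simp add: T_def)
      then show ?thesis by (simp add: mconst_def mult_single)
    qed
    then show "p \<in> mpoly.span T"
      by (subst poly_mapping_sum_single) (rule mpoly.span_sum)
  qed
  moreover have "finite T" "card T \<le> Suc d ^ card W"
    using \<open>finite M\<close> cM card_image_le[OF \<open>finite M\<close>, of "\<lambda>m. Poly_Mapping.single m (1::'k)"]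
    by (simp_all add: T_def)
  ultimately show ?thesis using that by blast
qed

text \<open>There are \<open>(n + 1) ^ length xs\<close> products with exponents at most \<open>n\<close>, in a space of
  dimension \<open>O(n ^ card W)\<close>.\<close>

lemma algebraically_dependent:
  fixes xs :: "('v, 'k::field) mpoly list"
  assumes W: "finite W" and xs: "set xs \<subseteq> carrier (mpoly_ring W)" and len: "card W < length xs"
  obtains A and c :: "nat list \<Rightarrow> 'k"
  where "finite A" "A \<subseteq> {as. length as = length xs}"
    "(\<Sum>as\<in>A. mconst (c as) * power_prod xs as) = 0" "\<exists>as\<in>A. c as \<noteq> 0"
proof -
  obtain d where d: "set xs \<subseteq> mpoly_box W d" using set_in_some_mpoly_box[OF xs] ..
  \<comment> \<open>\<open>k\<close> is chosen so that the box bound plus one is at most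
    \<open>k * Suc n\<close> for every \<open>n\<close>. Taking \<open>n = k ^ card W\<close> then
    bounds the dimension by \<open>n * Suc n ^ card W\<close>, which is less than
    \<open>Suc n ^ Suc (card W)\<close>.\<close>
  define k where "k = Suc (length xs * d)"
  define n where "n = k ^ card W"
  define A where "A = {as. set as \<subseteq> {..n} \<and> length as = length xs}"
  have fA: "finite A" unfolding A_def by (rule finite_lists_length_eq) simp
  have cA: "card A = Suc n ^ length xs" unfolding A_def by (subst card_lists_length_eq) simp_all
  have box: "power_prod xs as \<in> mpoly_box W (length xs * (n * d))" if "as \<in> A" for as
    using that by (intro mpoly_box_power_prod[OF d]) (auto simp: A_def)
  obtain T :: "('v, 'k) mpoly set" where T: "finite T" "card T \<le> Suc (length xs * (n * d)) ^ card W"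
    "mpoly_box W (length xs * (n * d)) \<subseteq> mpoly.span T"
    using mpoly_box_spanning[OF W] by blast
  have "Suc (length xs * (n * d)) \<le> k * Suc n" by (simp add: k_def)
  then have "card T \<le> (k * Suc n) ^ card W" using T(2) power_mono le_trans by blast
  also have "\<dots> = n * Suc n ^ card W" unfolding power_mult_distrib by (simp add: n_def)
  also have "\<dots> < Suc n * Suc n ^ card W" by simp
  also have "\<dots> \<le> Suc n ^ length xs" unfolding power_Suc[symmetric]
    using len by (intro power_increasing) auto
  finally have big: "card T < card A" using cA by simp
  show ?thesis
  \<comment> \<open>Linear dependence concerns the set of products and yields coefficients on
    exponent lists when distinct lists have distinct products. Otherwise two lists with equal
    products give a relation with coefficients 1 and -1.\<close>
  proof (cases "inj_on (power_prod xs) A")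
    case True
    let ?S = "power_prod xs ` A"
    have "mpoly.dependent ?S"
    proof (rule ccontr)
      assume "mpoly.independent ?S"
      then have "card ?S \<le> card T"
        using mpoly.independent_span_bound[OF T(1)] T(3) box by blast
      then show False using big card_image[OF True] by simp
    qed
    then obtain u where u: "\<exists>p\<in>?S. u p \<noteq> 0" "(\<Sum>p\<in>?S. mconst (u p) * p) = 0"
      using mpoly.dependent_finite[of ?S] fA by auto
    show ?thesis
    proof (rule that[OF fA])
      show "A \<subseteq> {as. length as = length xs}" by (auto simp: A_def)
      show "(\<Sum>as\<in>A. mconst (u (power_prod xs as)) * power_prod xs as) = 0"
        using u(2) by (simp add: sum.reindex[OF True])
      show "\<exists>as\<in>A. u (power_prod xs as) \<noteq> 0" using u(1) by auto
    qed
  next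
    case False
    then obtain as bs where ab: "as \<in> A" "bs \<in> A" "as \<noteq> bs" "power_prod xs as = power_prod xs bs"
      by (auto simp: inj_on_def)
    show ?thesis
    proof (rule that[of "{as, bs}" "\<lambda>cs. if cs = as then 1 else - 1"])
      show "{as, bs} \<subseteq> {as. length as = length xs}" using ab by (auto simp: A_def)
      have "mconst (- 1) = (- 1 :: ('v, 'k) mpoly)"
        by (simp add: mconst_def single_uminus)
      then show "(\<Sum>cs\<in>{as, bs}. mconst (if cs = as then 1 else - 1) * power_prod xs cs) = 0"
        using ab(3,4) by simp
    qed auto
  qed
qed

text \<open>\<open>W\<close> is to be the complement of the vertex cover read off from
  \<open>P 0\<close>. A longer chain would give polynomials in \<open>W\<close> that are both
  independent modulo \<open>P 0\<close> and dependent.\<close>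

lemma prime_chain_length_le:
  fixes P :: "nat \<Rightarrow> ('v, 'k::field) mpoly set"
  assumes V: "finite V" and W: "W \<subseteq> V"
    and P: "\<And>i. i \<le> n \<Longrightarrow> primeideal (P i) (mpoly_ring V)"
    and chain: "\<And>i. i < n \<Longrightarrow> P i \<subset> P (Suc i)"
    and vars: "\<And>v. v \<in> V - W \<Longrightarrow> mvar v \<in> P 0"
  shows "n \<le> card W"
proof (rule ccontr)
  assume "\<not> n \<le> card W"
  then have n: "card W < n" by simp
  have I: "ideal (P i) (mpoly_ring V)" if "i \<le> n" for i
    using P[OF that] mpoly_primeideal_ideal by blast
  have P0: "P 0 \<subseteq> P i" if "i \<le> n" for i
    using that
  proof (induction i)
    case (Suc i)
    then show ?case using chain[of i] by (meson Suc_leD Suc_le_lessD order_trans psubset_imp_subset)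
  qed simp
  have "\<exists>q \<in> carrier (mpoly_ring W). q \<in> P (Suc i) - P i" if i: "i < n" for i
  proof -
    obtain p where p: "p \<in> P (Suc i)" "p \<notin> P i" using chain[OF i] by blast
    \<comment> \<open>\<open>q\<close> drops the terms of \<open>p\<close> that involve a variable
      outside \<open>W\<close>. These lie in \<open>P 0\<close>, hence in every prime of the chain,
      so \<open>q\<close> separates \<open>P i\<close> from \<open>P (Suc i)\<close> just as
      \<open>p\<close> does.\<close>
    define q where "q = (\<Sum>m\<in>{m\<in>Poly_Mapping.keys p. Poly_Mapping.keys m \<subseteq> W}.
        Poly_Mapping.single m (Poly_Mapping.lookup p m))"
    have lookup_q: "Poly_Mapping.lookup q m
        = (if Poly_Mapping.keys m \<subseteq> W then Poly_Mapping.lookup p m else 0)" for m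
      by (auto simp: q_def lookup_sum lookup_single when_def in_keys_iff)
    have q: "q \<in> carrier (mpoly_ring W)"
      unfolding carrier_mpoly_ring_iff
    proof
      show "Poly_Mapping.keys m \<subseteq> W" if "m \<in> Poly_Mapping.keys q" for m
        using that by (auto simp: in_keys_iff[of m q] lookup_q split: if_splits)
    qed
    have pV: "p \<in> carrier (mpoly_ring V)"
      using mpoly_ideal_sub_carrier[OF I p(1)] i by simp
    have keys_diff: "m \<in> Poly_Mapping.keys (p - q) \<longleftrightarrow> m \<in> Poly_Mapping.keys p \<and> \<not> Poly_Mapping.keys m \<subseteq> W" for m
      by (simp add: in_keys_iff lookup_minus lookup_q)
    have "p - q \<in> var_ideal V (V - W)"
      using pV by (fastforce simp: var_ideal_def carrier_mpoly_ring_iff keys_diff)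
    then have "p - q \<in> P 0"
      using var_ideal_subset[OF I, of 0 "V - W"] vars by blast
    then have "p - q \<in> P i" "p - q \<in> P (Suc i)" using P0[of i] P0[of "Suc i"] i by auto
    then have "q \<in> P (Suc i)" "q \<notin> P i"
      using mpoly_ideal_diff[OF I[of "Suc i"] p(1), of "p - q"]
        mpoly_ideal_add[OF I[of i], of "p - q" q] p(2) i by auto
    then show ?thesis using q by blast
  qed
  then obtain f where f: "\<And>i. i < n \<Longrightarrow> f i \<in> carrier (mpoly_ring W)"
    "\<And>i. i < n \<Longrightarrow> f i \<in> P (Suc i) - P i" by metis
  define xs where "xs = map f [0..<n]"
  have len: "length xs = n" by (simp add: xs_def)
  have nth: "xs ! i = f i" if "i < n" for i using that by (simp add: xs_def)
  have xscar: "set xs \<subseteq> carrier (mpoly_ring W)" using f(1) by (auto simp: xs_def)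
  have "card W < length xs" using n len by simp
  then obtain A and c :: "nat list \<Rightarrow> 'k"
    where A: "finite A" "A \<subseteq> {as. length as = length xs}"
      "(\<Sum>as\<in>A. mconst (c as) * power_prod xs as) = 0" "\<exists>as\<in>A. c as \<noteq> 0"
    by (rule algebraically_dependent[OF finite_subset[OF W V] xscar])
  have "c as = 0" if as: "as \<in> A" for as
  proof (rule prime_chain_algebraically_independent[of xs P V A c])
    show "(\<Sum>as\<in>A. mconst (c as) * power_prod xs as) \<in> P 0"
      using A(3) mpoly_ideal_0[OF I[of 0]] by simp
    show "primeideal (P i) (mpoly_ring V)" if "i \<le> length xs" for i
      using P that len by simp
    show "P i \<subseteq> P (Suc i)" if "i < length xs" for i
      using chain[of i] that len by (simp add: psubset_eq)
    show "xs ! i \<in> P (Suc i) - P i" if "i < length xs" for i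
      using f(2)[of i] nth[of i] that len by simp
  qed (fact A(1,2) as)+
  then show False using A(4) by blast
qed

section \<open>The dimension of edge rings\<close>

lemma vertex_cover_verts:
  assumes "simple_graph H"
  shows "vertex_cover H (verts H)"
proof -
  have "e \<inter> verts H \<noteq> {}" if "e \<in> edges H" for e
  proof -
    have "e \<subseteq> verts H" "card e = 2" using assms that by (auto simp: simple_graph_def)
    then show ?thesis by (metis Int_absorb2 card.empty zero_neq_numeral)
  qed
  then show ?thesis by (simp add: vertex_cover_def)
qed

lemma covering_number_le: "vertex_cover H C \<Longrightarrow> covering_number H \<le> card C"
  unfolding covering_number_def by (rule Least_le) blast

lemma minimum_vertex_cover:
  assumes "simple_graph H"
  obtains C where "vertex_cover H C" "card C = covering_number H"
proof -
  have "\<exists>C. vertex_cover H C \<and> card C = covering_number H"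
    unfolding covering_number_def
    by (rule LeastI_ex) (use vertex_cover_verts[OF assms] in blast)
  then show ?thesis using that by blast
qed

lemma edge_monomials_carrier:
  assumes "simple_graph H"
  shows "{mvar x * mvar y |x y. {x, y} \<in> edges H} \<subseteq> carrier (mpoly_ring (verts H))"
proof -
  have "x \<in> verts H \<and> y \<in> verts H" if "{x, y} \<in> edges H" for x y
    using assms that unfolding simple_graph_def by blast
  then show ?thesis by (auto intro!: mpoly_ring_mult)
qed

lemma edge_ideal_ideal:
  assumes "simple_graph H"
  shows "ideal (edge_ideal H :: ('v, 'k::field) mpoly set) (mpoly_ring (verts H))"
proof -
  interpret cring "mpoly_ring (verts H) :: ('v, 'k) mpoly ring" by (rule mpoly_ring_cring)
  show ?thesis unfolding edge_ideal_def by (rule genideal_ideal[OF edge_monomials_carrier[OF assms]])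
qed

lemma edge_monomial_in_edge_ideal:
  assumes "simple_graph H" "{x, y} \<in> edges H"
  shows "mvar x * mvar y \<in> (edge_ideal H :: ('v, 'k::field) mpoly set)"
proof -
  interpret cring "mpoly_ring (verts H) :: ('v, 'k) mpoly ring" by (rule mpoly_ring_cring)
  show ?thesis unfolding edge_ideal_def
    using genideal_self[OF edge_monomials_carrier[OF assms(1)]] assms(2) by blast
qed

lemma edge_ideal_subset:
  fixes I :: "('v, 'k::field) mpoly set"
  assumes "ideal I (mpoly_ring (verts H))"
    and "\<And>x y. {x, y} \<in> edges H \<Longrightarrow> mvar x * mvar y \<in> I"
  shows "edge_ideal H \<subseteq> I"
proof -
  interpret cring "mpoly_ring (verts H) :: ('v, 'k) mpoly ring" by (rule mpoly_ring_cring)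
  show ?thesis unfolding edge_ideal_def
    by (rule genideal_minimal[OF assms(1)]) (use assms(2) in blast)
qed

lemma edge_ideal_subset_var_ideal:
  assumes H: "simple_graph H" and C: "\<And>e. e \<in> edges H \<Longrightarrow> e \<inter> C \<noteq> {}"
  shows "edge_ideal H \<subseteq> (var_ideal (verts H) C :: ('v, 'k::field) mpoly set)"
proof (rule edge_ideal_subset[OF var_ideal_ideal])
  fix x y assume xy: "{x, y} \<in> edges H"
  then have V: "x \<in> verts H" "y \<in> verts H" using H unfolding simple_graph_def by blast+
  have "x \<in> C \<or> y \<in> C" using C[OF xy] by blast
  then show "mvar x * mvar y \<in> (var_ideal (verts H) C :: ('v, 'k) mpoly set)"
    using mpoly_ideal_mult[OF var_ideal_ideal, of "mvar x" "verts H" C "mvar y"]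
      mpoly_ideal_mult[OF var_ideal_ideal, of "mvar y" "verts H" C "mvar x"] V
    by (auto simp: mvar_in_var_ideal)
qed

text \<open>The product of the two ends of an edge lies in \<open>P\<close>, so primality puts one
  end into \<open>P\<close>.\<close>

lemma vertex_cover_of_primeideal:
  assumes H: "simple_graph H" and P: "primeideal P (mpoly_ring (verts H))" and "edge_ideal H \<subseteq> P"
  shows "vertex_cover H {v \<in> verts H. mvar v \<in> P}"
  unfolding vertex_cover_def
proof (intro conjI ballI)
  fix e assume e: "e \<in> edges H"
  then have "card e = 2" "e \<subseteq> verts H" using H by (auto simp: simple_graph_def)
  then obtain x y where xy: "e = {x, y}" "x \<in> verts H" "y \<in> verts H"
    by (auto simp: card_2_iff)
  have "mvar x * mvar y \<in> P"
    using edge_monomial_in_edge_ideal[OF H] e xy(1) assms(3) by blast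
  then have "mvar x \<in> P \<or> mvar y \<in> P"
    using mpoly_primeideal_mult[OF P] xy(2,3) by simp
  then show "e \<inter> {v \<in> verts H. mvar v \<in> P} \<noteq> {}" using xy by blast
qed auto

lemma edge_ring_prime_chain_exists:
  assumes H: "simple_graph H"
  defines "n \<equiv> card (verts H) - covering_number H"
  shows "\<exists>P :: nat \<Rightarrow> ('v, 'k::field) mpoly set.
    (\<forall>i\<le>n. primeideal (P i) (mpoly_ring (verts H)) \<and> edge_ideal H \<subseteq> P i) \<and>
    (\<forall>i<n. P i \<subset> P (Suc i))"
proof -
  have fin: "finite (verts H)" using H by (simp add: simple_graph_def)
  obtain C where C: "vertex_cover H C" "card C = covering_number H"
    using minimum_vertex_cover[OF H] .
  have CV: "C \<subseteq> verts H" using C(1) by (simp add: vertex_cover_def)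
  obtain vs where vs: "set vs = verts H - C" "distinct vs"
    using finite_distinct_list[of "verts H - C"] fin by blast
  have len: "length vs = n"
    using distinct_card[OF vs(2)] vs(1) C(2) card_Diff_subset[OF finite_subset[OF CV fin] CV]
    by (simp add: n_def)
  \<comment> \<open>The chain starts at the ideal of the minimum cover and adds one further vertex
    at each step; since \<open>vs\<close> has length \<open>n\<close>, \<open>P n\<close> is the
    ideal of all variables.\<close>
  define P where "P i = (var_ideal (verts H) (C \<union> set (take i vs)) :: ('v, 'k) mpoly set)" for i
  show ?thesis
  proof (intro exI[of _ P] conjI allI impI)
    have "edge_ideal H \<subseteq> P i" for i
      unfolding P_def using C(1) by (intro edge_ideal_subset_var_ideal[OF H]) (auto simp: vertex_cover_def)
    then show "edge_ideal H \<subseteq> P i" for i .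
    show "primeideal (P i) (mpoly_ring (verts H))" for i
      unfolding P_def by (rule var_ideal_primeideal[OF fin])
    show "P i \<subset> P (Suc i)" if i: "i < n" for i
    proof
      show "P i \<subseteq> P (Suc i)"
        using set_take_subset_set_take[of i "Suc i" vs] unfolding P_def var_ideal_def by fastforce
      have mem: "vs ! i \<in> verts H - C" using nth_mem[of i vs] vs(1) len i by auto
      have take: "take (Suc i) vs = take i vs @ [vs ! i]"
        using i len by (simp add: take_Suc_conv_app_nth)
      have "distinct (take (Suc i) vs)" using vs(2) by (rule distinct_take)
      then have "vs ! i \<notin> set (take i vs)" unfolding take by simp
      then have "mvar (vs ! i) \<in> P (Suc i)" "mvar (vs ! i) \<notin> P i"
        using mem by (simp_all add: P_def mvar_in_var_ideal take)
      then show "P i \<noteq> P (Suc i)" by metis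
    qed
  qed
qed

text \<open>The truncated subtraction is exact, because the set of all vertices is itself a
  cover.\<close>

theorem krull_dim_edge_ring:
  fixes H :: "'v graph"
  assumes H: "simple_graph H"
  shows "krull_dim (edge_ring H :: ('v, 'k::field) mpoly set ring)
    = enat (card (verts H) - covering_number H)"
proof -
  let ?R = "mpoly_ring (verts H) :: ('v, 'k) mpoly ring"
  let ?I = "edge_ideal H :: ('v, 'k) mpoly set"
  interpret cring ?R by (rule mpoly_ring_cring)
  have fin: "finite (verts H)" using H by (simp add: simple_graph_def)
  have le: "n \<le> card (verts H) - covering_number H"
    if P: "\<And>i. i \<le> n \<Longrightarrow> primeideal (P i) ?R \<and> ?I \<subseteq> P i"
      and chain: "\<And>i. i < n \<Longrightarrow> P i \<subset> P (Suc i)" for n P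
  proof -
    define C where "C = {v \<in> verts H. mvar v \<in> P 0}"
    have "covering_number H \<le> card C"
      unfolding C_def using P[of 0] by (intro covering_number_le vertex_cover_of_primeideal[OF H]) auto
    moreover have "n \<le> card (verts H - C)"
      by (rule prime_chain_length_le[OF fin, of _ n P]) (use P chain in \<open>auto simp: C_def\<close>)
    moreover have "card (verts H - C) = card (verts H) - card C"
      using fin by (intro card_Diff_subset) (auto simp: C_def)
    ultimately show ?thesis by linarith
  qed
  show ?thesis
    unfolding krull_dim_def edge_ring_def prime_chain_quot_iff[OF edge_ideal_ideal[OF H]]
  proof (rule antisym)
    show "Sup {enat n |n. \<exists>P. (\<forall>i\<le>n. primeideal (P i) ?R \<and> ?I \<subseteq> P i) \<and> (\<forall>i<n. P i \<subset> P (Suc i))}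
      \<le> enat (card (verts H) - covering_number H)"
    proof (rule Sup_least)
      fix d assume "d \<in> {enat n |n. \<exists>P. (\<forall>i\<le>n. primeideal (P i) ?R \<and> ?I \<subseteq> P i) \<and> (\<forall>i<n. P i \<subset> P (Suc i))}"
      then obtain n P where d: "d = enat n"
        and P: "\<forall>i\<le>n. primeideal (P i) ?R \<and> ?I \<subseteq> P i" "\<forall>i<n. P i \<subset> P (Suc i)" by blast
      show "d \<le> enat (card (verts H) - covering_number H)"
        unfolding d enat_ord_simps by (rule le[of n P]) (use P in blast)+
    qed
    show "enat (card (verts H) - covering_number H)
      \<le> Sup {enat n |n. \<exists>P. (\<forall>i\<le>n. primeideal (P i) ?R \<and> ?I \<subseteq> P i) \<and> (\<forall>i<n. P i \<subset> P (Suc i))}"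
      by (rule Sup_upper) (use edge_ring_prime_chain_exists[OF H, where 'k = 'k] in blast)
  qed
qed

section \<open>Joining systems of parameters\<close>

lemma linear_form_mono:
  assumes "finite W" "V \<subseteq> W" "linear_form V f"
  shows "linear_form W f"
proof -
  obtain c where c: "f = (\<Sum>x\<in>V. mconst (c x) * mvar x)"
    using assms(3) by (auto simp: linear_form_def)
  have "f = (\<Sum>x\<in>W. mconst (if x \<in> V then c x else 0) * mvar x)"
    unfolding c by (rule sum.mono_neutral_cong_left) (use assms in auto)
  then show ?thesis
    unfolding linear_form_def by (intro exI[of _ "\<lambda>x. if x \<in> V then c x else 0"])
qed

text \<open>Linear forms have no constant term. This keeps the ideal of a joined system inside the
  ideal of all variables.\<close>

lemma linear_form_in_var_ideal:
  assumes "linear_form V f"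
  shows "f \<in> var_ideal V V"
proof -
  obtain c where c: "f = (\<Sum>x\<in>V. mconst (c x) * mvar x)"
    using assms by (auto simp: linear_form_def)
  show ?thesis unfolding c
    by (intro mpoly_ideal_sum[OF var_ideal_ideal] mpoly_ideal_mult(1)[OF var_ideal_ideal])
      (simp_all add: mvar_in_var_ideal)
qed

text \<open>The half-open list \<open>[1..<Suc s]\<close> enumerates the index set
  \<open>{1..s}\<close>.\<close>

lemma set_concat_map_upt: "set (concat (map f [1..<Suc s])) = (\<Union>i\<in>{1..s}. set (f i))"
  by (simp only: set_concat set_map set_upt atLeastLessThanSuc_atLeastAtMost image_image)

lemma linear_sop_concat:
  fixes F :: "nat \<Rightarrow> ('v, 'k::field) mpoly list"
  assumes G: "simple_graph G" and red: "covering_reduction G s Gs"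
    and sop: "\<And>i. i \<in> {1..s} \<Longrightarrow> linear_sop (Gs i) (F i)"
  shows "linear_sop G (concat (map F [1..<Suc s]))"
proof -
  let ?V = "verts G"
  let ?R = "mpoly_ring ?V :: ('v, 'k) mpoly ring"
  let ?fs = "concat (map F [1..<Suc s])"
  define J where "J = genideal ?R (edge_ideal G \<union> set ?fs)"
  interpret cring ?R by (rule mpoly_ring_cring)
  have fin: "finite ?V" using G by (simp add: simple_graph_def)
  have sub: "simple_graph (Gs i)" "verts (Gs i) \<subseteq> ?V" "edges (Gs i) \<subseteq> edges G" if "i \<in> {1..s}" for i
    using red that by (auto simp: covering_reduction_def subgraph_of_def)
  have UN: "(\<Union>i\<in>{1..s}. verts (Gs i)) = ?V"
    and disj: "disjoint_family_on (\<lambda>i. verts (Gs i)) {1..s}"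
    and cov: "covering_number G = (\<Sum>i=1..s. covering_number (Gs i))"
    using red by (simp_all add: covering_reduction_def)
  have finV: "finite (verts (Gs i))" if "i \<in> {1..s}" for i
    using sub(2)[OF that] fin finite_subset by blast
  have set_fs: "set ?fs = (\<Union>i\<in>{1..s}. set (F i))" by (rule set_concat_map_upt)

  have forms: "linear_form ?V f" if f: "f \<in> set ?fs" for f
  proof -
    obtain i where i: "i \<in> {1..s}" "f \<in> set (F i)" using f unfolding set_fs by blast
    then have "linear_form (verts (Gs i)) f" using sop by (simp add: linear_sop_def)
    then show ?thesis by (rule linear_form_mono[OF fin sub(2)[OF i(1)]])
  qed

  \<comment> \<open>The dimension formula is read backwards here, to obtain the length of each given
    system.\<close>
  have lenF: "length (F i) = card (verts (Gs i)) - covering_number (Gs i)" if "i \<in> {1..s}" for i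
    using sop[OF that] krull_dim_edge_ring[OF sub(1)[OF that], where 'k = 'k]
    by (simp add: linear_sop_def)
  have "length ?fs = (\<Sum>i=1..s. length (F i))"
    by (simp add: length_concat comp_def interv_sum_list_conv_sum_set_nat atLeastLessThanSuc_atLeastAtMost del: upt_Suc)
  also have "\<dots> = (\<Sum>i=1..s. card (verts (Gs i)) - covering_number (Gs i))"
    by (rule sum.cong[OF refl lenF])
  \<comment> \<open>Natural number subtraction may be pulled out of the sum because no covering
    number exceeds the number of vertices.\<close>
  also have "\<dots> = (\<Sum>i=1..s. card (verts (Gs i))) - (\<Sum>i=1..s. covering_number (Gs i))"
    by (rule sum_subtractf_nat) (rule covering_number_le[OF vertex_cover_verts[OF sub(1)]])
  also have "(\<Sum>i=1..s. card (verts (Gs i))) = card ?V"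
    unfolding UN[symmetric] using finV disj
    by (intro card_UN_disjoint[symmetric]) (auto simp: disjoint_family_on_def)
  finally have dim: "enat (length ?fs) = krull_dim (edge_ring G :: ('v, 'k) mpoly set ring)"
    using krull_dim_edge_ring[OF G, where 'k = 'k] cov by simp

  have vars: "ideal (var_ideal ?V ?V) ?R" by (rule var_ideal_ideal)
  have gens_var: "edge_ideal G \<union> set ?fs \<subseteq> var_ideal ?V ?V"
  proof -
    have "edge_ideal G \<subseteq> (var_ideal ?V ?V :: ('v, 'k) mpoly set)"
      using vertex_cover_verts[OF G] by (intro edge_ideal_subset_var_ideal[OF G]) (simp add: vertex_cover_def)
    then show ?thesis using linear_form_in_var_ideal[OF forms] by blast
  qed
  have gens: "edge_ideal G \<union> set ?fs \<subseteq> carrier ?R"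
    using gens_var mpoly_ideal_sub_carrier[OF vars] by blast
  have J: "ideal J ?R" unfolding J_def by (rule genideal_ideal[OF gens])
  have gens_J: "edge_ideal G \<subseteq> J" "set ?fs \<subseteq> J" using genideal_self[OF gens] by (auto simp: J_def)

  have rad: "radical ?R J = var_ideal ?V ?V"
  proof
    have "J \<subseteq> var_ideal ?V ?V" unfolding J_def by (rule genideal_minimal[OF vars gens_var])
    \<comment> \<open>A prime ideal containing \<open>J\<close> also contains its radical.\<close>
    then show "radical ?R J \<subseteq> var_ideal ?V ?V"
      using mpoly_primeideal_power[OF var_ideal_primeideal[OF fin]] by (auto simp: radical_def)
    show "var_ideal ?V ?V \<subseteq> radical ?R J"
    \<comment> \<open>As the radical is an ideal, it is enough to find a power of each single
      variable in \<open>J\<close>.\<close>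
    proof (rule var_ideal_subset[OF radical_ideal[OF J]])
      fix x assume "x \<in> ?V"
      then obtain i where i: "i \<in> {1..s}" "x \<in> verts (Gs i)" using UN by blast
      let ?Ri = "mpoly_ring (verts (Gs i)) :: ('v, 'k) mpoly ring"
      interpret Ri: cring ?Ri by (rule mpoly_ring_cring)
      have "mvar x \<in> var_ideal (verts (Gs i)) (verts (Gs i))" using i by (simp add: mvar_in_var_ideal)
      also have "\<dots> = radical ?Ri (genideal ?Ri (edge_ideal (Gs i) \<union> set (F i)))"
        using sop[OF i(1)] by (simp add: linear_sop_def genideal_mvar)
      finally obtain n where n: "0 < n" "mvar x ^ n \<in> genideal ?Ri (edge_ideal (Gs i) \<union> set (F i))"
        by (auto simp: radical_def)
      \<comment> \<open>The power of \<open>x\<close> lies in an ideal generated in the smaller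
        ring. Contracting \<open>J\<close> to that ring lets minimality of this ideal carry the
        power over to \<open>J\<close>.\<close>
      have Ji: "ideal (J \<inter> carrier ?Ri) ?Ri" by (rule mpoly_ideal_restrict[OF J sub(2)[OF i(1)]])
      have "edge_ideal (Gs i) \<subseteq> J \<inter> carrier ?Ri"
      proof (rule edge_ideal_subset[OF Ji])
        fix x y assume xy: "{x, y} \<in> edges (Gs i)"
        have "mvar x * mvar y \<in> J"
          using edge_monomial_in_edge_ideal[OF G] xy sub(3)[OF i(1)] gens_J(1) by blast
        moreover have "mvar x * mvar y \<in> carrier ?Ri"
          using edge_monomials_carrier[OF sub(1)[OF i(1)]] xy by blast
        ultimately show "mvar x * mvar y \<in> J \<inter> carrier ?Ri" by blast
      qed
      moreover have "set (F i) \<subseteq> J \<inter> carrier ?Ri"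
      proof
        fix f assume f: "f \<in> set (F i)"
        then have "f \<in> J" using gens_J(2) set_fs i(1) by blast
        moreover have "f \<in> var_ideal (verts (Gs i)) (verts (Gs i))"
          using sop[OF i(1)] f by (intro linear_form_in_var_ideal) (simp add: linear_sop_def)
        ultimately show "f \<in> J \<inter> carrier ?Ri" by (simp add: var_ideal_def)
      qed
      ultimately have "genideal ?Ri (edge_ideal (Gs i) \<union> set (F i)) \<subseteq> J \<inter> carrier ?Ri"
        by (intro Ri.genideal_minimal[OF Ji]) simp
      then have "mvar x ^ n \<in> J" using n(2) by blast
      then show "mvar x \<in> radical ?R J"
        using n(1) \<open>x \<in> ?V\<close> by (auto simp: radical_def)
    qed
  qed
  show ?thesis
    unfolding linear_sop_def genideal_mvar[OF order_refl]
    using forms dim rad unfolding J_def by blast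
qed

text \<open>The forms stay the same polynomials in the larger ring, so their coefficients do not
  change.\<close>

lemma zero_one_linear_sop_concat:
  fixes F :: "nat \<Rightarrow> ('v, 'k::field) mpoly list"
  assumes "simple_graph G" "covering_reduction G s Gs"
    and "\<And>i. i \<in> {1..s} \<Longrightarrow> zero_one_linear_sop (Gs i) (F i)"
  shows "zero_one_linear_sop G (concat (map F [1..<Suc s]))"
proof -
  have "linear_sop G (concat (map F [1..<Suc s]))"
    using assms(3) by (intro linear_sop_concat[OF assms(1,2)]) (simp only: zero_one_linear_sop_def)
  moreover have "Poly_Mapping.lookup f m \<in> {0, 1}" if f: "f \<in> set (concat (map F [1..<Suc s]))" for f m
  proof -
    obtain i where "i \<in> {1..s}" "f \<in> set (F i)" using f unfolding set_concat_map_upt by blast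
    then show ?thesis using assms(3) unfolding zero_one_linear_sop_def by blast
  qed
  ultimately show ?thesis unfolding zero_one_linear_sop_def by blast
qed

lemma list_all2_concat_map:
  assumes "\<And>i. i \<in> set is \<Longrightarrow> list_all2 Q (f i) (g i)"
  shows "list_all2 Q (concat (map f is)) (concat (map g is))"
  using assms by (induction "is") (auto intro: list_all2_appendI)

text \<open>Stating the condition on centres and forms as a list relation makes it compatible with
  concatenation.\<close>

lemma star_sop_iff_list_all2:
  "star_sop H zs fs \<longleftrightarrow> zero_one_linear_sop H fs \<and> set zs \<subseteq> verts H \<and>
    list_all2 (\<lambda>z f. \<exists>A. A \<subseteq> nbhd H z \<and> f = mvar z + (\<Sum>x\<in>A. mvar x)) zs fs"
  by (auto simp: star_sop_def list_all2_conv_all_nth)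

text \<open>Edges of \<open>Gs i\<close> are edges of \<open>G\<close>, so neighbourhoods only grow
  and the same sets \<open>A\<close> remain witnesses.\<close>

lemma star_sop_concat:
  fixes F :: "nat \<Rightarrow> ('v, 'k::field) mpoly list"
  assumes G: "simple_graph G" and red: "covering_reduction G s Gs"
    and star: "\<And>i. i \<in> {1..s} \<Longrightarrow> star_sop (Gs i) (Z i) (F i)"
  shows "star_sop G (concat (map Z [1..<Suc s])) (concat (map F [1..<Suc s]))"
proof -
  have sub: "verts (Gs i) \<subseteq> verts G" "edges (Gs i) \<subseteq> edges G" if "i \<in> {1..s}" for i
    using red that by (auto simp: covering_reduction_def subgraph_of_def)
  have "set (concat (map Z [1..<Suc s])) \<subseteq> verts G"
  proof
    fix z assume "z \<in> set (concat (map Z [1..<Suc s]))"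
    then obtain i where i: "i \<in> {1..s}" "z \<in> set (Z i)" unfolding set_concat_map_upt by blast
    have "set (Z i) \<subseteq> verts (Gs i)" using star[OF i(1)] by (simp add: star_sop_def)
    then show "z \<in> verts G" using sub(1)[OF i(1)] i(2) by blast
  qed
  moreover have "list_all2 (\<lambda>z f. \<exists>A. A \<subseteq> nbhd G z \<and> f = mvar z + (\<Sum>x\<in>A. mvar x))
      (concat (map Z [1..<Suc s])) (concat (map F [1..<Suc s]))"
  proof (rule list_all2_concat_map)
    fix i assume "i \<in> set [1..<Suc s]"
    then have i: "i \<in> {1..s}" by auto
    have "nbhd (Gs i) z \<subseteq> nbhd G z" for z using sub(2)[OF i] by (auto simp: nbhd_def)
    then show "list_all2 (\<lambda>z f. \<exists>A. A \<subseteq> nbhd G z \<and> f = mvar z + (\<Sum>x\<in>A. mvar x)) (Z i) (F i)"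
      using star[OF i] unfolding star_sop_iff_list_all2 by (blast intro: list_all2_mono)
  qed
  moreover have "zero_one_linear_sop G (concat (map F [1..<Suc s]))"
    using star by (intro zero_one_linear_sop_concat[OF G red]) (simp add: star_sop_def)
  ultimately show ?thesis unfolding star_sop_iff_list_all2 by blast
qed

theorem proposition4p17:
  fixes G :: "'v graph" and Gs :: "nat \<Rightarrow> 'v graph" and s :: nat
  assumes "simple_graph G"
    and "covering_reduction G s Gs"
  shows "((\<forall>i\<in>{1..s}. has_zero_one_linear_sop TYPE('k::field) (Gs i)) \<longrightarrow>
            has_zero_one_linear_sop TYPE('k) G) \<and>
         ((\<forall>i\<in>{1..s}. has_star_sop TYPE('k) (Gs i)) \<longrightarrow>
            has_star_sop TYPE('k) G)"
proof (intro conjI impI)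
  assume "\<forall>i\<in>{1..s}. has_zero_one_linear_sop TYPE('k) (Gs i)"
  then obtain F :: "nat \<Rightarrow> ('v, 'k) mpoly list"
    where "\<And>i. i \<in> {1..s} \<Longrightarrow> zero_one_linear_sop (Gs i) (F i)"
    unfolding has_zero_one_linear_sop_def by metis
  then show "has_zero_one_linear_sop TYPE('k) G"
    unfolding has_zero_one_linear_sop_def using zero_one_linear_sop_concat[OF assms] by blast
next
  assume "\<forall>i\<in>{1..s}. has_star_sop TYPE('k) (Gs i)"
  then obtain Z and F :: "nat \<Rightarrow> ('v, 'k) mpoly list"
    where "\<And>i. i \<in> {1..s} \<Longrightarrow> star_sop (Gs i) (Z i) (F i)"
    unfolding has_star_sop_def by metis
  then show "has_star_sop TYPE('k) G"
    unfolding has_star_sop_def using star_sop_concat[OF assms] by blast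
qed

end
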